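(* Let $1\le s_1<s_2<\dots<s_k$ be fixed integers, $k\ge1$, and let $d=\gcd(s_1,\dots,s_k)$. For $n>2s_k$ let $\tau(n)$ be the number of spanning trees of the circulant graph $C_n(s_1,\dots,s_k)$. Then $$\tau(n)\sim\frac{n\,d^2}{q}A^n\quad\text{as } n\to\infty \text{ with } \gcd(n,d)=1,$$ where $q=s_1^2+\dots+s_k^2$ and $$A=\exp\Bigl(\int_0^1\log|L(e^{2\pi i t})|\,dt\Bigr)$$ is the Mahler measure of the Laurent polynomial $L(z)=2k-\sum_{i=1}^k(z^{s_i}+z^{-s_i})$.
   Context: $C_n(s_1,\dots,s_k)$ is the graph with vertices $0,1,\dots,n-1$ in which each vertex $i$ is adjacent to the vertices $i\pm s_1,\dots,i\pm s_k\pmod n$. The notation $f(n)\sim g(n)$ means $f(n)/g(n)\to1$. *)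

theory Defs
  imports "HOL-Analysis.Analysis" "HOL-Library.Landau_Symbols"
begin

text \<open>
  Undirected graphs are given by a vertex set \<open>V\<close> and a set \<open>E\<close> of edges \<open>{u, v}\<close>. The spanning
  trees of the AFP entry Graph_Theory are not suitable here: they are subdigraphs without directed
  cycles, so an acyclic orientation of an undirected cycle may be part of one.
\<close>

definition graph_connected :: "'a set \<Rightarrow> 'a set set \<Rightarrow> bool" where
  "graph_connected V E \<longleftrightarrow> (\<forall>u\<in>V. \<forall>v\<in>V. (u, v) \<in> {(x, y). {x, y} \<in> E}\<^sup>*)"

definition graph_cycle :: "'a set set \<Rightarrow> 'a list \<Rightarrow> bool" where
  "graph_cycle E xs \<longleftrightarrow> length xs \<ge> 3 \<and> distinct xs \<and>
     (\<forall>i<length xs. {xs ! i, xs ! (Suc i mod length xs)} \<in> E)"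

definition graph_acyclic :: "'a set set \<Rightarrow> bool" where
  "graph_acyclic E \<longleftrightarrow> (\<nexists>xs. graph_cycle E xs)"

definition is_tree :: "'a set \<Rightarrow> 'a set set \<Rightarrow> bool" where
  "is_tree V E \<longleftrightarrow> V \<noteq> {} \<and> graph_connected V E \<and> graph_acyclic E"

text \<open>A spanning tree has vertex set \<open>V\<close> and is therefore identified with its edge set.\<close>

definition spanning_trees :: "'a set \<Rightarrow> 'a set set \<Rightarrow> 'a set set set" where
  "spanning_trees V E = {T. T \<subseteq> E \<and> is_tree V T}"

text \<open>
  For \<open>n\<close> larger than twice every element of \<open>S\<close>, and \<open>0 \<notin> S\<close>, the edges below form a simple
  graph, regular of degree \<open>2 * card S\<close>. For smaller \<open>n\<close> there may be loops (singleton edges), and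
  parallel edges are identified.
\<close>

definition circulant_edges :: "nat \<Rightarrow> nat set \<Rightarrow> nat set set" where
  "circulant_edges n S = {{i, j} | i j. i < n \<and> j < n \<and>
     (\<exists>s\<in>S. int j = (int i + int s) mod int n \<or> int j = (int i - int s) mod int n)}"

definition num_circulant_spanning_trees :: "nat \<Rightarrow> nat set \<Rightarrow> nat" where
  "num_circulant_spanning_trees n S = card (spanning_trees {..<n} (circulant_edges n S))"

definition circulant_laurent :: "nat \<Rightarrow> (nat \<Rightarrow> nat) \<Rightarrow> complex \<Rightarrow> complex" where
  "circulant_laurent k s z = 2 * of_nat k - (\<Sum>i=1..k. z ^ s i + z powi (- int (s i)))"

text \<open>
  The convention \<open>ln 0 = 0\<close> affects the integrand only at zeros of \<open>f\<close> on the unit circle, which is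
  a finite set for a nonzero Laurent polynomial \<open>f\<close>.
\<close>

definition mahler_measure :: "(complex \<Rightarrow> complex) \<Rightarrow> real" where
  "mahler_measure f =
     exp (integral {0..1} (\<lambda>t. ln (norm (f (exp (2 * of_real pi * \<i> * of_real t))))))"

end

theory Submission
  imports Defs "Jordan_Normal_Form.Determinant" "HOL-Complex_Analysis.Cauchy_Integral_Formula"
    "HOL-Computational_Algebra.Fundamental_Theorem_Algebra"
begin

text \<open>
  Three facts combine. First, the circulant graph is a Cayley graph of the cyclic group, so its
  Laplacian is diagonalised by the characters \<open>j \<mapsto> w ^ (j * c)\<close>, where \<open>w\<close> is a primitive \<open>n\<close>-th root
  of unity, and the eigenvalue at \<open>c\<close> is the value \<open>L (w ^ c)\<close> of the Laurent polynomial. The matrix-tree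
  theorem (\<open>matrix_tree\<close>) turns this into \<open>n * \<tau>(n) = (\<Prod>0 < c < n. L (w ^ c))\<close>
  (\<open>circulant_tree_number\<close>).

  Second, \<open>z ^ s + z ^ (- s) - 2 = z ^ (- s) * (z ^ s - 1)\<^sup>2\<close> and \<open>z ^ d - 1\<close> divides every \<open>z ^ s i - 1\<close>.
  Hence \<open>L\<close> factors, up to a sign and a power of \<open>z\<close>, as \<open>(z ^ d - 1)\<^sup>2 * R z\<close> with an explicit polynomial
  \<open>R\<close> (\<open>laurent_factorization\<close>). This \<open>R\<close> has no zero on the unit circle, because
  \<open>L z = 0\<close> with \<open>\<bar>z\<bar> = 1\<close> forces every \<open>z ^ s i\<close>, hence \<open>z ^ d\<close>, to be 1, and at such points
  \<open>R z = q / d\<^sup>2\<close>. If \<open>n\<close> is prime to \<open>d\<close>, then \<open>w ^ d\<close> is again primitive and the factors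
  \<open>w ^ (c * d) - 1\<close> with \<open>0 < c < n\<close> have product \<open>n\<close> up to sign. With \<open>r\<close> the leading coefficient of \<open>R\<close>
  and \<open>a\<close> running over its roots, this gives the exact formula
  \<open>\<tau>(n) = n * d\<^sup>2 / q * \<bar>r\<bar> ^ n * (\<Prod>a. \<bar>a ^ n - 1\<bar>)\<close> (\<open>circulant_tree_number_eq\<close>).

  Third, by Jensen's formula \<open>A = \<bar>r\<bar> * (\<Prod>a. max 1 \<bar>a\<bar>)\<close> (\<open>mahler_measure_laurent\<close>); the roots of
  \<open>z ^ d - 1\<close> have absolute value 1 and contribute nothing. The ratio of the two sides of the claim is thus the
  product of the numbers \<open>\<bar>a ^ n - 1\<bar> / max 1 \<bar>a\<bar> ^ n\<close>, each of which tends to 1 since \<open>\<bar>a\<bar> \<noteq> 1\<close>.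
\<close>

section \<open>Spanning trees and parent functions\<close>


definition simple_edges :: "'a set \<Rightarrow> 'a set set \<Rightarrow> bool" where
  "simple_edges V E \<longleftrightarrow> (\<forall>e\<in>E. \<exists>u\<in>V. \<exists>v\<in>V. u \<noteq> v \<and> e = {u, v})"

definition parent_edges :: "'a set \<Rightarrow> 'a \<Rightarrow> ('a \<Rightarrow> 'a) \<Rightarrow> 'a set set" where
  "parent_edges V r f = (\<lambda>v. {v, f v}) ` (V - {r})"

text \<open>
  Iterating \<open>f\<close> leads from every vertex to \<open>r\<close>. Stating this by a height that drops along \<open>f\<close> lets later
  arguments use induction on heights and extremal vertices without mentioning iterates.
\<close>

definition rooted :: "'a set \<Rightarrow> 'a \<Rightarrow> ('a \<Rightarrow> 'a) \<Rightarrow> bool" where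
  "rooted V r f \<longleftrightarrow> (\<exists>h :: 'a \<Rightarrow> nat. \<forall>v\<in>V - {r}. h (f v) < h v)"

text \<open>
  The root gets itself as its value, and functions are extensional outside \<open>V\<close>, so that distinct
  members differ at a vertex other than the root.
\<close>

definition parent_functions :: "'a set \<Rightarrow> 'a \<Rightarrow> 'a set set \<Rightarrow> ('a \<Rightarrow> 'a) set" where
  "parent_functions V r E = (\<Pi>\<^sub>E v\<in>V. if v = r then {r} else {w. {v, w} \<in> E})"

lemma simple_edgesD:
  assumes "simple_edges V E" "{u, v} \<in> E"
  shows "u \<in> V" "v \<in> V" "u \<noteq> v"
proof -
  obtain a b where "a \<in> V" "b \<in> V" "a \<noteq> b" "{u, v} = {a, b}"
    using assms unfolding simple_edges_def by blast
  then show "u \<in> V" "v \<in> V" "u \<noteq> v" by (auto simp: doubleton_eq_iff)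
qed

lemma parent_functionsD:
  assumes "f \<in> parent_functions V r E" "v \<in> V" "v \<noteq> r"
  shows "{v, f v} \<in> E"
  using assms unfolding parent_functions_def by (auto dest!: PiE_mem)

lemma parent_functions_root: "f \<in> parent_functions V r E \<Longrightarrow> r \<in> V \<Longrightarrow> f r = r"
  unfolding parent_functions_def by (auto dest: PiE_mem)

lemma parent_functions_closed:
  assumes "simple_edges V E" "r \<in> V" "f \<in> parent_functions V r E" "v \<in> V"
  shows "f v \<in> V"
proof (cases "v = r")
  case True
  then show ?thesis using parent_functions_root[OF assms(3,2)] assms(2) by simp
next
  case False
  then show ?thesis using parent_functionsD[OF assms(3,4)] simple_edgesD[OF assms(1)] by blast
qed

lemma sym_adjacency: "sym {(x, y). {x, y} \<in> E}"
  by (auto simp: sym_def insert_commute)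

lemma connected_to_root:
  assumes "\<And>v. v \<in> V \<Longrightarrow> (v, r) \<in> {(x, y). {x, y} \<in> E}\<^sup>*"
  shows "graph_connected V E"
  unfolding graph_connected_def
proof (intro ballI)
  fix u v assume "u \<in> V" "v \<in> V"
  then have "(u, r) \<in> {(x, y). {x, y} \<in> E}\<^sup>*" "(v, r) \<in> {(x, y). {x, y} \<in> E}\<^sup>*"
    using assms by auto
  note this(1) symD[OF sym_rtrancl[OF sym_adjacency] this(2)]
  then show "(u, v) \<in> {(x, y). {x, y} \<in> E}\<^sup>*" by (rule rtrancl_trans)
qed

lemma parent_edges_is_tree:
  assumes "r \<in> V" "f ` V \<subseteq> V" "rooted V r f"
  shows "is_tree V (parent_edges V r f)"
proof -
  let ?T = "parent_edges V r f"
  obtain h :: "'a \<Rightarrow> nat" where h: "\<And>v. v \<in> V \<Longrightarrow> v \<noteq> r \<Longrightarrow> h (f v) < h v"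
    using assms(3) unfolding rooted_def by auto
  have "(v, r) \<in> {(x, y). {x, y} \<in> ?T}\<^sup>*" if "v \<in> V" for v
    using that
  proof (induction "h v" arbitrary: v rule: less_induct)
    case less
    show ?case
    proof (cases "v = r")
      case False
      then have "(f v, r) \<in> {(x, y). {x, y} \<in> ?T}\<^sup>*"
        using less h assms(2) by blast
      moreover have "{v, f v} \<in> ?T" using False less.prems unfolding parent_edges_def by blast
      ultimately show ?thesis by (simp add: converse_rtrancl_into_rtrancl)
    qed simp
  qed
  then have "graph_connected V ?T" by (rule connected_to_root)
  moreover have "graph_acyclic ?T"
    unfolding graph_acyclic_def
  proof
    assume "\<exists>xs. graph_cycle ?T xs"
    then obtain xs where len: "length xs \<ge> 3" and dist: "distinct xs"
      and edge: "\<And>i. i < length xs \<Longrightarrow> {xs ! i, xs ! (Suc i mod length xs)} \<in> ?T"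
      unfolding graph_cycle_def by blast
    \<comment> \<open>Both neighbours on the cycle of a vertex of maximal height would be its parent.\<close>
    obtain i where i: "i < length xs" and max: "\<And>j. j < length xs \<Longrightarrow> h (xs ! j) \<le> h (xs ! i)"
    proof -
      let ?H = "(\<lambda>j. h (xs ! j)) ` {..<length xs}"
      have "?H \<noteq> {}" using len by (auto simp: lessThan_empty_iff bot_nat_def)
      then have "Max ?H \<in> ?H" by (intro Max_in) auto
      then obtain i where "i < length xs" "h (xs ! i) = Max ?H" by auto
      then show ?thesis by (intro that[of i]) auto
    qed
    define p where "p = (i + (length xs - 1)) mod length xs"
    define n where "n = Suc i mod length xs"
    have "length xs > 0" using len by auto
    then have p: "p < length xs" and n: "n < length xs" unfolding p_def n_def by auto
    have pi: "Suc p mod length xs = i"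
    proof -
      have "Suc (i + (length xs - 1)) = i + length xs" using len by simp
      then show ?thesis unfolding p_def mod_Suc_eq using i by simp
    qed
    have "p \<noteq> n"
    proof
      assume "p = n"
      then have "Suc (Suc i) mod length xs = i" using pi unfolding n_def by (simp add: mod_Suc_eq)
      then show False using i len by (auto simp: mod_if split: if_splits)
    qed
    have parent: "f (xs ! i) = w" if "{xs ! i, w} \<in> ?T" "h w \<le> h (xs ! i)" for w
      using that h unfolding parent_edges_def by (force simp: doubleton_eq_iff)
    have "f (xs ! i) = xs ! n"
      using edge[OF i] max[OF n] unfolding n_def by (intro parent)
    moreover have "f (xs ! i) = xs ! p"
      using edge[OF p] max[OF p] unfolding pi by (intro parent) (auto simp: insert_commute)
    ultimately show False
      using \<open>p \<noteq> n\<close> p n dist by (simp add: nth_eq_iff_index_eq)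
  qed
  ultimately show ?thesis using assms(1) unfolding is_tree_def by blast
qed

text \<open>
  A tree with a chosen root determines the parent of each vertex: going up by height, \<open>v\<close> cannot be the
  parent of \<open>f v\<close> because the parent of \<open>f v\<close> is already known to be \<open>f (f v)\<close>, which is strictly lower.
\<close>

lemma parent_edges_inj:
  assumes "rooted V r f" "f ` V \<subseteq> V" "parent_edges V r f = parent_edges V r g"
    and "v \<in> V" "v \<noteq> r"
  shows "f v = g v"
proof -
  obtain h :: "'a \<Rightarrow> nat" where h: "\<And>v. v \<in> V \<Longrightarrow> v \<noteq> r \<Longrightarrow> h (f v) < h v"
    using assms(1) unfolding rooted_def by auto
  show ?thesis using assms(4,5)
  proof (induction "h v" arbitrary: v rule: less_induct)
    case (less v)
    have "{v, f v} \<in> parent_edges V r g"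
      using less.prems assms(3) unfolding parent_edges_def by blast
    then obtain u where "u \<noteq> r" "{v, f v} = {u, g u}" unfolding parent_edges_def by blast
    then consider "g v = f v" | "f v \<noteq> r" "g (f v) = v" by (auto simp: doubleton_eq_iff)
    then show ?case
    proof cases
      case 2
      have fv: "f v \<in> V" "h (f v) < h v" using less.prems assms(2) h by auto
      then have "f (f v) = v" using less.hyps[of "f v"] 2 by auto
      then show ?thesis using h[OF fv(1) 2(1)] fv(2) by simp
    qed simp
  qed
qed

text \<open>
  A walk is shortened by cutting out the closed part whenever the new first vertex occurs again.
\<close>

lemma simple_path_exists:
  assumes "(u, v) \<in> {(x, y). {x, y} \<in> E}\<^sup>*"
  obtains xs where "distinct xs" "xs \<noteq> []" "hd xs = u" "last xs = v"
    "\<And>i. Suc i < length xs \<Longrightarrow> {xs ! i, xs ! Suc i} \<in> E"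
proof -
  let ?P = "\<lambda>u xs. distinct xs \<and> xs \<noteq> [] \<and> hd xs = u \<and> last xs = v \<and>
    (\<forall>i. Suc i < length xs \<longrightarrow> {xs ! i, xs ! Suc i} \<in> E)"
  from assms have "\<exists>xs. ?P u xs"
  proof (induction rule: converse_rtrancl_induct)
    case base
    then show ?case by (intro exI[of _ "[v]"]) simp
  next
    case (step u w)
    then obtain xs where xs: "?P w xs" by blast
    show ?case
    proof (cases "u \<in> set xs")
      case True
      then obtain ys zs where ys: "xs = ys @ u # zs" by (auto simp: in_set_conv_decomp)
      have "{(u # zs) ! i, (u # zs) ! Suc i} \<in> E" if "Suc i < length (u # zs)" for i
      proof -
        have "Suc (length ys + i) < length xs" using that ys by simp
        then have "{xs ! (length ys + i), xs ! Suc (length ys + i)} \<in> E" using xs by blast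
        then show ?thesis using ys by (simp add: nth_append)
      qed
      then have "?P u (u # zs)" using xs ys by auto
      then show ?thesis by blast
    next
      case False
      have "{(u # xs) ! i, (u # xs) ! Suc i} \<in> E" if "Suc i < length (u # xs)" for i
        using that xs step(1) by (cases i) (auto simp: hd_conv_nth)
      then have "?P u (u # xs)" using xs False by auto
      then show ?thesis by blast
    qed
  qed
  then show ?thesis using that by blast
qed

text \<open>
  Trees are minimal among connected edge sets: an edge of \<open>T\<close> outside \<open>F\<close> would close a simple path in
  \<open>F\<close> between its ends to a cycle in \<open>T\<close>.
\<close>

lemma acyclic_connected_subset_eq:
  assumes "simple_edges V T" "graph_acyclic T" "F \<subseteq> T" "graph_connected V F"
  shows "F = T"
proof (rule ccontr)
  assume "F \<noteq> T"
  then obtain e where e: "e \<in> T" "e \<notin> F" using assms(3) by blast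
  obtain u v where uv: "u \<in> V" "v \<in> V" "u \<noteq> v" "e = {u, v}"
    using assms(1) e(1) unfolding simple_edges_def by blast
  have "(u, v) \<in> {(x, y). {x, y} \<in> F}\<^sup>*" using assms(4) uv unfolding graph_connected_def by blast
  then obtain xs where xs: "distinct xs" "xs \<noteq> []" "hd xs = u" "last xs = v"
    "\<And>i. Suc i < length xs \<Longrightarrow> {xs ! i, xs ! Suc i} \<in> F" by (rule simple_path_exists) blast
  have len: "length xs \<ge> 3"
  proof (rule ccontr)
    assume "\<not> length xs \<ge> 3"
    moreover have "length xs \<noteq> 0" using xs(2) by simp
    ultimately consider "length xs = 1" | "length xs = 2" by linarith
    then show False
    proof cases
      case 1
      then show ?thesis using xs uv by (auto simp: length_Suc_conv)
    next
      case 2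
      then have "{u, v} \<in> F" using xs(3,4) xs(5)[of 0] by (auto simp: length_Suc_conv numeral_2_eq_2)
      then show ?thesis using e uv by simp
    qed
  qed
  have "{xs ! i, xs ! (Suc i mod length xs)} \<in> T" if "i < length xs" for i
  proof (cases "Suc i < length xs")
    case True
    then show ?thesis using xs(5) assms(3) by auto
  next
    case False
    then have i: "Suc i = length xs" using that by simp
    then have "i = length xs - 1" by simp
    then have "xs ! i = v" "xs ! 0 = u"
      using xs by (simp_all add: last_conv_nth hd_conv_nth)
    then show ?thesis using i e(1) uv(4) by (simp add: insert_commute)
  qed
  then have "graph_cycle T xs" using len xs(1) unfolding graph_cycle_def by blast
  then show False using assms(2) unfolding graph_acyclic_def by blast
qed

text \<open>
  The parent of \<open>v\<close> is a neighbour that is closer to the root. These edges alone connect everything,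
  so they make up the whole tree.
\<close>

lemma tree_has_parent_function:
  assumes "r \<in> V" "simple_edges V T" "is_tree V T"
  obtains f where "f \<in> parent_functions V r T" "rooted V r f" "parent_edges V r f = T"
proof -
  let ?A = "{(x, y). {x, y} \<in> T}"
  define dist where "dist v = (LEAST m. (v, r) \<in> ?A ^^ m)" for v
  have reach: "\<exists>m. (v, r) \<in> ?A ^^ m" if "v \<in> V" for v
    using assms(1,3) that unfolding is_tree_def graph_connected_def by (blast dest: rtrancl_imp_relpow)
  have "\<exists>w. {v, w} \<in> T \<and> dist w < dist v" if v: "v \<in> V" "v \<noteq> r" for v
  proof -
    have *: "(v, r) \<in> ?A ^^ dist v" unfolding dist_def by (rule LeastI_ex) (rule reach[OF v(1)])
    then obtain m where m: "dist v = Suc m" using v(2) by (cases "dist v") auto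
    then obtain w where w: "{v, w} \<in> T" "(w, r) \<in> ?A ^^ m"
      using * by (metis (no_types, lifting) CollectD case_prodD relpow_Suc_D2)
    then have "dist w \<le> m" unfolding dist_def by (intro Least_le)
    then show ?thesis using w m by auto
  qed
  then obtain g where g: "\<And>v. v \<in> V \<Longrightarrow> v \<noteq> r \<Longrightarrow> {v, g v} \<in> T \<and> dist (g v) < dist v" by metis
  define f where "f = (\<lambda>v\<in>V. if v = r then r else g v)"
  have f: "f \<in> parent_functions V r T"
    unfolding parent_functions_def f_def using g by (auto intro!: PiE_I)
  have rooted: "rooted V r f"
    unfolding rooted_def f_def using g by (intro exI[of _ dist]) auto
  have "f ` V \<subseteq> V" using parent_functions_closed[OF assms(2,1) f] by blast
  then have "is_tree V (parent_edges V r f)" using parent_edges_is_tree rooted assms(1) by metis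
  moreover have "parent_edges V r f \<subseteq> T"
    using parent_functionsD[OF f] unfolding parent_edges_def by blast
  ultimately have "parent_edges V r f = T"
    using acyclic_connected_subset_eq assms(2,3) unfolding is_tree_def by metis
  then show ?thesis using that f rooted by blast
qed

text \<open>
  This replaces the incidence matrix and the Cauchy-Binet formula in the matrix-tree theorem: trees are
  counted as functions, which is what the expansion of a determinant along its rows produces.
\<close>

lemma bij_betw_parent_functions_spanning_trees:
  assumes "r \<in> V" "simple_edges V E"
  shows "bij_betw (parent_edges V r) {f \<in> parent_functions V r E. rooted V r f} (spanning_trees V E)"
  unfolding bij_betw_def
proof
  show "inj_on (parent_edges V r) {f \<in> parent_functions V r E. rooted V r f}"
  proof (rule inj_onI, clarify)
    fix f g
    assume f: "f \<in> parent_functions V r E" "rooted V r f" and g: "g \<in> parent_functions V r E"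
      and eq: "parent_edges V r f = parent_edges V r g"
    have "f ` V \<subseteq> V" using parent_functions_closed[OF assms(2,1) f(1)] by blast
    then have off_root: "f v = g v" if "v \<in> V" "v \<noteq> r" for v
      using parent_edges_inj[OF f(2) _ eq that] by blast
    have "f r = g r"
      using parent_functions_root[OF f(1) assms(1)] parent_functions_root[OF g assms(1)] by simp
    then have "f v = g v" if "v \<in> V" for v using off_root[OF that] by (cases "v = r") blast+
    then show "f = g"
      using PiE_ext[OF f(1)[unfolded parent_functions_def] g[unfolded parent_functions_def]] by blast
  qed
  show "parent_edges V r ` {f \<in> parent_functions V r E. rooted V r f} = spanning_trees V E"
  proof (intro equalityI subsetI)
    fix T assume "T \<in> parent_edges V r ` {f \<in> parent_functions V r E. rooted V r f}"
    then obtain f where f: "f \<in> parent_functions V r E" "rooted V r f" "T = parent_edges V r f" by blast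
    have "f ` V \<subseteq> V" using parent_functions_closed[OF assms(2,1) f(1)] by blast
    then have "is_tree V T" unfolding f(3) by (rule parent_edges_is_tree[OF assms(1) _ f(2)])
    moreover have "T \<subseteq> E"
      unfolding f(3) parent_edges_def using parent_functionsD[OF f(1)] by blast
    ultimately show "T \<in> spanning_trees V E" unfolding spanning_trees_def by blast
  next
    fix T assume "T \<in> spanning_trees V E"
    then have T: "T \<subseteq> E" "is_tree V T" unfolding spanning_trees_def by auto
    then have "simple_edges V T" using assms(2) unfolding simple_edges_def by blast
    then obtain f where f: "f \<in> parent_functions V r T" "rooted V r f" "parent_edges V r f = T"
      by (rule tree_has_parent_function[OF assms(1) _ T(2)])
    have "f \<in> parent_functions V r E"
      unfolding parent_functions_def
    proof (rule PiE_I)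
      fix v assume v: "v \<in> V"
      show "f v \<in> (if v = r then {r} else {w. {v, w} \<in> E})"
        using parent_functions_root[OF f(1) assms(1)] parent_functionsD[OF f(1) v] T(1) by auto
    next
      fix v assume "v \<notin> V"
      then show "f v = undefined" using f(1) unfolding parent_functions_def by (rule PiE_arb[rotated])
    qed
    then show "T \<in> parent_edges V r ` {f \<in> parent_functions V r E. rooted V r f}" using f by blast
  qed
qed

section \<open>The matrix-tree theorem\<close>


text \<open>
  Multilinearity of the determinant in all rows at once. Applied to the Laplacian, whose row \<open>i\<close> is a sum
  over the neighbours of \<open>i\<close>, a choice function \<open>f\<close> picks one neighbour for every vertex.
\<close>

lemma det_sum_rows:
  fixes B :: "nat \<Rightarrow> 'b \<Rightarrow> nat \<Rightarrow> 'a :: comm_ring_1"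
  assumes "\<And>i. i < n \<Longrightarrow> finite (A i)"
  shows "Determinant.det (Matrix.mat n n (\<lambda>(i, j). \<Sum>a\<in>A i. B i a j)) =
    (\<Sum>f\<in>Pi\<^sub>E {0..<n} A. Determinant.det (Matrix.mat n n (\<lambda>(i, j). B i (f i) j)))"
proof -
  have "Determinant.det (Matrix.mat n n (\<lambda>(i, j). \<Sum>a\<in>A i. B i a j)) =
      (\<Sum>p\<in>{p. p permutes {0..<n}}. signof p * (\<Prod>i = 0..<n. \<Sum>a\<in>A i. B i a (p i)))"
    by (subst det_def'[of _ n]) (auto intro!: sum.cong prod.cong)
  also have "\<dots> = (\<Sum>p\<in>{p. p permutes {0..<n}}. \<Sum>f\<in>Pi\<^sub>E {0..<n} A. signof p * (\<Prod>i = 0..<n. B i (f i) (p i)))"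
    using assms by (intro sum.cong refl, subst prod_sum_PiE) (simp_all add: sum_distrib_left)
  also have "\<dots> = (\<Sum>f\<in>Pi\<^sub>E {0..<n} A. \<Sum>p\<in>{p. p permutes {0..<n}}. signof p * (\<Prod>i = 0..<n. B i (f i) (p i)))"
    by (rule sum.swap)
  also have "\<dots> = (\<Sum>f\<in>Pi\<^sub>E {0..<n} A. Determinant.det (Matrix.mat n n (\<lambda>(i, j). B i (f i) j)))"
    by (intro sum.cong refl, subst det_def'[of _ n]) (auto intro!: sum.cong prod.cong)
  finally show ?thesis .
qed

lemma det_sum_first_row:
  fixes w :: "'b \<Rightarrow> nat \<Rightarrow> 'a :: comm_ring_1"
  assumes "n > 0"
  shows "Determinant.det (Matrix.mat n n (\<lambda>(i, j). if i = 0 then (\<Sum>a\<in>A. w a j) else m i j)) =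
    (\<Sum>a\<in>A. Determinant.det (Matrix.mat n n (\<lambda>(i, j). if i = 0 then w a j else m i j)))"
proof -
  have eq: "Determinant.det (Matrix.mat n n (\<lambda>(i, j). if i = 0 then v j else m i j)) =
    (\<Sum>p\<in>{p. p permutes {0..<n}}. v (p 0) * (signof p * (\<Prod>i\<in>{Suc 0..<n}. m i (p i))))" for v
    by (subst det_def'[of _ n])
      (auto intro!: sum.cong prod.cong simp: prod.atLeast_Suc_lessThan[OF assms] mult_ac)
  show ?thesis unfolding eq sum_distrib_right by (rule sum.swap)
qed

lemma det_eq_zero_of_zero_row_sums:
  fixes m :: "nat \<Rightarrow> nat \<Rightarrow> 'a :: idom"
  assumes "v j \<noteq> 0" "j < n" "\<And>i. i < n \<Longrightarrow> (\<Sum>j<n. m i j * v j) = 0"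
  shows "Determinant.det (Matrix.mat n n (\<lambda>(i, j). m i j)) = 0"
proof -
  let ?M = "Matrix.mat n n (\<lambda>(i, j). m i j)"
  have "Matrix.vec n v \<noteq> 0\<^sub>v n" using assms(1,2) by (metis index_vec index_zero_vec(1))
  moreover have "?M *\<^sub>v Matrix.vec n v = 0\<^sub>v n"
    using assms(3) by (intro eq_vecI) (simp_all add: scalar_prod_def atLeast0LessThan)
  ultimately show ?thesis
    using det_0_iff_vec_prod_zero[of ?M n] vec_carrier mat_carrier by blast
qed

text \<open>
  If the other rows sum to zero, the determinant depends on the first row only through its sum: the difference
  of two unit vectors as first row gives a matrix that annihilates the all-ones vector.
\<close>

lemma det_unit_first_row:
  fixes m :: "nat \<Rightarrow> nat \<Rightarrow> 'a :: idom"
  assumes "a < n" "\<And>i. 0 < i \<Longrightarrow> i < n \<Longrightarrow> (\<Sum>j<n. m i j) = 0"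
  shows "Determinant.det (Matrix.mat n n (\<lambda>(i, j). if i = 0 then of_bool (j = a) else m i j)) =
    Determinant.det (Matrix.mat n n (\<lambda>(i, j). if i = 0 then of_bool (j = 0) else m i j))"
proof -
  \<comment> \<open>Split the unit vector at \<open>a\<close> into the unit vector at 0 and a difference.\<close>
  define w :: "bool \<Rightarrow> nat \<Rightarrow> 'a"
    where "w b j = (if b then of_bool (j = a) - of_bool (j = 0) else of_bool (j = 0))" for b j
  have n: "n > 0" using assms(1) by simp
  have "(\<Sum>j<n. (if i = 0 then w True j else m i j) * 1) = 0" if "i < n" for i
    using assms that n by (cases "i = 0") (simp_all add: w_def sum_subtractf of_bool_def)
  then have "Determinant.det (Matrix.mat n n (\<lambda>(i, j). if i = 0 then w True j else m i j)) = 0"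
    using n by (intro det_eq_zero_of_zero_row_sums[where v = "\<lambda>_. 1" and j = 0]) auto
  moreover have "Determinant.det (Matrix.mat n n (\<lambda>(i, j). if i = 0 then of_bool (j = a) else m i j)) =
     (\<Sum>b\<in>UNIV. Determinant.det (Matrix.mat n n (\<lambda>(i, j). if i = 0 then w b j else m i j)))"
    unfolding det_sum_first_row[OF n, symmetric]
    by (intro arg_cong[where f = Determinant.det] cong_mat) (simp_all add: w_def UNIV_bool)
  moreover have "w False = (\<lambda>j. of_bool (j = 0))" by (simp add: w_def fun_eq_iff)
  ultimately show ?thesis by (simp add: UNIV_bool cong: if_cong)
qed

definition parent_matrix :: "nat \<Rightarrow> (nat \<Rightarrow> nat) \<Rightarrow> 'a :: ring_1 mat" where
  "parent_matrix n f = Matrix.mat n n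
     (\<lambda>(i, j). if i = 0 then of_bool (j = 0) else of_bool (j = i) - of_bool (j = f i))"

text \<open>
  In the Leibniz formula a permutation contributes only if it sends each \<open>i\<close> to \<open>i\<close> or to \<open>f i\<close>. Such a
  permutation never raises the height, and it preserves the total height, so it is the identity.
\<close>

lemma det_parent_matrix_rooted:
  assumes "rooted {..<n} 0 f"
  shows "Determinant.det (parent_matrix n f :: 'a :: comm_ring_1 mat) = 1"
proof -
  obtain h :: "nat \<Rightarrow> nat" where "\<forall>v\<in>{..<n} - {0}. h (f v) < h v"
    using assms unfolding rooted_def by blast
  then have h: "h (f v) < h v" if "v < n" "v \<noteq> 0" for v using that by blast
  let ?m = "\<lambda>i j. if i = 0 then of_bool (j = 0) else of_bool (j = i) - of_bool (j = f i) :: 'a"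
  have diag: "(\<Prod>i = 0..<n. ?m i (id i)) = 1"
  proof (rule prod.neutral, rule ballI)
    fix i assume "i \<in> {0..<n}"
    then have "i \<noteq> 0 \<longrightarrow> i \<noteq> f i" using h[of i] by fastforce
    then show "?m i (id i) = 1" by (cases "i = 0") simp_all
  qed
  have zero: "(\<Prod>i = 0..<n. ?m i (p i)) = 0" if p: "p permutes {0..<n}" "p \<noteq> id" for p
  proof (rule ccontr)
    assume nz: "(\<Prod>i = 0..<n. ?m i (p i)) \<noteq> 0"
    have cases: "p i = i \<or> (i \<noteq> 0 \<and> p i = f i)" if "i < n" for i
    proof (rule ccontr)
      assume "\<not> (p i = i \<or> (i \<noteq> 0 \<and> p i = f i))"
      then have z: "?m i (p i) = 0" by (cases "i = 0") simp_all
      have "\<exists>j\<in>{0..<n}. ?m j (p j) = 0"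
      proof (rule bexI[where x = i])
        show "?m i (p i) = 0" by (rule z)
      qed (simp add: that)
      then have "(\<Prod>j = 0..<n. ?m j (p j)) = 0" by (rule prod_zero[OF finite_atLeastLessThan])
      with nz show False by (rule notE)
    qed
    obtain k where k: "p k \<noteq> k" using p(2) by (auto simp: fun_eq_iff)
    have "k < n"
    proof (rule ccontr)
      assume "\<not> k < n"
      then have "p k = k" using permutes_not_in[OF p(1), of k] by simp
      then show False using k by simp
    qed
    have "(\<Sum>i = 0..<n. h (p i)) < (\<Sum>i = 0..<n. h i)"
    proof (rule sum_strict_mono_ex1)
      show "\<forall>i\<in>{0..<n}. h (p i) \<le> h i"
      proof
        fix i assume "i \<in> {0..<n}"
        then show "h (p i) \<le> h i" using cases[of i] h[of i] by fastforce
      qed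
      have "h (p k) < h k" using cases[OF \<open>k < n\<close>] k h[OF \<open>k < n\<close>] by simp
      then show "\<exists>i\<in>{0..<n}. h (p i) < h i" using \<open>k < n\<close> by (intro bexI[of _ k]) simp_all
    qed simp
    moreover have "(\<Sum>i = 0..<n. h (p i)) = (\<Sum>i = 0..<n. h i)"
      using sum.permute[OF p(1), of h] by (simp add: comp_def)
    ultimately show False by simp
  qed
  have "Determinant.det (parent_matrix n f :: 'a mat) =
      (\<Sum>p\<in>{p. p permutes {0..<n}}. signof p * (\<Prod>i = 0..<n. ?m i (p i)))"
    unfolding parent_matrix_def
    by (subst det_def'[of _ n], simp) (intro sum.cong prod.cong arg_cong2[where f = "(*)"] refl, auto)
  also have "\<dots> = (\<Sum>p\<in>{id}. signof p * (\<Prod>i = 0..<n. ?m i (p i)))"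
    using zero by (intro sum.mono_neutral_right) (auto simp: finite_permutations permutes_id)
  also have "\<dots> = signof (id :: nat \<Rightarrow> nat)"
    by (subst sum.insert) (simp_all only: finite.emptyI empty_iff not_False_eq_True sum.empty diag mult_1_right add_0_right)
  also have "\<dots> = 1" by (simp add: sign_id)
  finally show ?thesis .
qed

text \<open>
  A vertex reaches the root under \<open>f\<close> if and only if its parent does. Hence the indicator function of the
  vertices that never reach the root lies in the kernel.
\<close>

lemma det_parent_matrix_not_rooted:
  assumes "\<not> rooted {..<n} 0 f" "n > 0" "f ` {..<n} \<subseteq> {..<n}"
  shows "Determinant.det (parent_matrix n f :: 'a :: idom mat) = 0"
proof -
  define g where "g v = (if v = 0 then 0 else f v)" for v
  define R where "R = {v. \<exists>m. (g ^^ m) v = 0}"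
  have step: "v \<in> R \<longleftrightarrow> f v \<in> R" if nonroot: "v \<noteq> 0" for v
  proof
    assume "v \<in> R"
    then obtain m where m: "(g ^^ m) v = 0" unfolding R_def by blast
    then obtain l where "m = Suc l" using nonroot by (cases m) simp_all
    then have "(g ^^ l) (f v) = 0" using m nonroot by (simp add: funpow_swap1 g_def)
    then show "f v \<in> R" unfolding R_def by blast
  next
    assume "f v \<in> R"
    then obtain l where "(g ^^ l) (f v) = 0" unfolding R_def by blast
    then have "(g ^^ Suc l) v = 0" using that by (simp add: funpow_swap1 g_def)
    then show "v \<in> R" unfolding R_def by blast
  qed
  \<comment> \<open>Otherwise the number of steps to the root would be a height.\<close>
  have "\<exists>j<n. j \<notin> R"
  proof (rule ccontr)
    assume "\<not> (\<exists>j<n. j \<notin> R)"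
    then have all: "\<exists>m. (g ^^ m) v = 0" if "v < n" for v using that unfolding R_def by blast
    have "(LEAST m. (g ^^ m) (f v) = 0) < (LEAST m. (g ^^ m) v = 0)" if v: "v < n" "v \<noteq> 0" for v
    proof -
      have "(g ^^ (LEAST m. (g ^^ m) v = 0)) v = 0" using all[OF v(1)] by (rule LeastI_ex)
      moreover obtain l where l: "(LEAST m. (g ^^ m) v = 0) = Suc l"
        using calculation v(2) by (cases "LEAST m. (g ^^ m) v = 0") auto
      ultimately have "(g ^^ l) (f v) = 0" using v(2) by (simp add: funpow_swap1 g_def)
      then show ?thesis unfolding l by (simp add: Least_le less_Suc_eq_le)
    qed
    then have "\<forall>v\<in>{..<n} - {0}. (LEAST m. (g ^^ m) (f v) = 0) < (LEAST m. (g ^^ m) v = 0)" by blast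
    then have "rooted {..<n} 0 f"
      unfolding rooted_def by (rule exI[where x = "\<lambda>v. LEAST m. (g ^^ m) v = 0"])
    then show False using assms(1) by blast
  qed
  then obtain j where j: "j < n" "j \<notin> R" by blast
  have "0 \<in> R" unfolding R_def by (auto intro: exI[of _ 0])
  let ?v = "\<lambda>j. of_bool (j \<notin> R) :: 'a"
  let ?m = "\<lambda>i j. if i = 0 then of_bool (j = 0) else of_bool (j = i) - of_bool (j = f i) :: 'a"
  have "(\<Sum>j<n. ?m i j * ?v j) = 0" if i: "i < n" for i
  proof (cases "i = 0")
    case True
    show ?thesis
    proof (rule sum.neutral, rule ballI)
      fix j show "?m i j * ?v j = 0" using True \<open>0 \<in> R\<close> by (cases "j = 0") simp_all
    qed
  next
    case False
    have delta: "(\<Sum>j<n. of_bool (j = a) * ?v j) = ?v a" if "a < n" for a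
      using that by (subst sum.remove[of _ a]) auto
    have "f i < n" using assms(3) i by auto
    have "(\<Sum>j<n. ?m i j * ?v j) = (\<Sum>j<n. of_bool (j = i) * ?v j) - (\<Sum>j<n. of_bool (j = f i) * ?v j)"
      using False by (simp only: if_False left_diff_distrib sum_subtractf)
    also have "\<dots> = ?v i - ?v (f i)" using delta[OF i] delta[OF \<open>f i < n\<close>] by simp
    also have "\<dots> = 0" using step[OF False] by simp
    finally show ?thesis .
  qed
  then show ?thesis
    unfolding parent_matrix_def using j by (intro det_eq_zero_of_zero_row_sums[where v = ?v and j = j]) auto
qed

lemma sum_rooted_parent_functions:
  assumes "finite V" "simple_edges V E" "r \<in> V"
  shows "(\<Sum>f\<in>parent_functions V r E. of_bool (rooted V r f)) =
    (of_nat (card (spanning_trees V E)) :: 'a :: semiring_1)"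
proof -
  let ?F = "parent_functions V r E"
  have "finite ?F"
    unfolding parent_functions_def
  proof (rule finite_PiE)
    fix v
    have "(if v = r then {r} else {w. {v, w} \<in> E}) \<subseteq> V"
      using simple_edgesD(2)[OF assms(2)] assms(3) by (auto split: if_split)
    then show "finite (if v = r then {r} else {w. {v, w} \<in> E})"
      by (rule finite_subset[OF _ assms(1)])
  qed (rule assms(1))
  then have "(\<Sum>f\<in>?F. of_bool (rooted V r f)) = (of_nat (card (?F \<inter> {f. rooted V r f})) :: 'a)"
    by simp
  also have "?F \<inter> {f. rooted V r f} = {f \<in> ?F. rooted V r f}" by blast
  also have "card \<dots> = card (spanning_trees V E)"
    using bij_betw_parent_functions_spanning_trees[OF assms(3,2)] by (rule bij_betw_same_card)
  finally show ?thesis .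
qed

text \<open>
  Having an all-ones row in place of a deleted row and column keeps the matrix adapted to the Fourier
  basis, at the price of the factor \<open>n\<close>: the all-ones row is the sum of \<open>n\<close> unit vectors, and each of them
  gives the same determinant.
\<close>

theorem matrix_tree:
  fixes E :: "nat set set"
  assumes "n > 0" "simple_edges {..<n} E"
  shows "Determinant.det (Matrix.mat n n (\<lambda>(i, j). if i = 0 then 1 else
      \<Sum>a | {i, a} \<in> E. of_bool (j = i) - of_bool (j = a))) =
    (of_nat (n * card (spanning_trees {..<n} E)) :: 'a :: idom)"
proof -
  let ?N = "\<lambda>i. {a. {i, a} \<in> E}"
  let ?m = "\<lambda>i j. \<Sum>a\<in>?N i. of_bool (j = i) - of_bool (j = a) :: 'a"
  let ?D = "\<lambda>w. Determinant.det (Matrix.mat n n (\<lambda>(i, j). if i = 0 then w j else ?m i j))"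
  have N: "?N i \<subseteq> {..<n}" for i using simple_edgesD[OF assms(2)] by blast
  have finA: "finite (if i = 0 then {0} else ?N i)" for i
  proof (rule finite_subset[OF _ finite_lessThan])
    show "(if i = 0 then {0} else ?N i) \<subseteq> {..<n}"
      using simple_edgesD(2)[OF assms(2)] assms(1) by (auto split: if_split)
  qed
  have rows: "(\<Sum>j<n. ?m i j) = 0" if "i < n" for i
  proof -
    have "(\<Sum>j<n. ?m i j) = (\<Sum>a\<in>?N i. \<Sum>j<n. of_bool (j = i) - of_bool (j = a))" by (rule sum.swap)
    also have "\<dots> = 0"
    proof (rule sum.neutral, rule ballI)
      fix a assume "a \<in> ?N i"
      then have "a < n" using N by blast
      then show "(\<Sum>j<n. of_bool (j = i) - of_bool (j = a) :: 'a) = 0"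
        using that by (simp add: sum_subtractf of_bool_def)
    qed
    finally show ?thesis .
  qed
  let ?F = "parent_functions {..<n} 0 E"
  have F: "?F = Pi\<^sub>E {0..<n} (\<lambda>i. if i = 0 then {0} else ?N i)"
    unfolding parent_functions_def by (simp add: atLeast0LessThan)
  have "?D (\<lambda>j. of_bool (j = 0)) = Determinant.det (Matrix.mat n n (\<lambda>(i, j).
      \<Sum>a\<in>(if i = 0 then {0} else ?N i). if i = 0 then of_bool (j = 0) else of_bool (j = i) - of_bool (j = a)))"
    by (intro arg_cong[where f = Determinant.det] cong_mat) auto
  also have "\<dots> = (\<Sum>f\<in>?F. Determinant.det (parent_matrix n f))"
    unfolding F parent_matrix_def
    by (rule det_sum_rows[where A = "\<lambda>i. if i = 0 then {0} else ?N i" and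
          B = "\<lambda>i a j. if i = 0 then of_bool (j = 0) else of_bool (j = i) - of_bool (j = a)"])
      (rule finA)
  finally have expand: "?D (\<lambda>j. of_bool (j = 0)) = (\<Sum>f\<in>?F. Determinant.det (parent_matrix n f))" .
  have rooted: "(\<Sum>f\<in>?F. Determinant.det (parent_matrix n f)) = (\<Sum>f\<in>?F. of_bool (rooted {..<n} 0 f) :: 'a)"
  proof (rule sum.cong[OF refl])
    fix f assume f: "f \<in> ?F"
    have closed: "f ` {..<n} \<subseteq> {..<n}"
      using parent_functions_closed[OF assms(2) _ f] assms(1) by blast
    show "Determinant.det (parent_matrix n f) = (of_bool (rooted {..<n} 0 f) :: 'a)"
    proof (cases "rooted {..<n} 0 f")
      case True
      then show ?thesis by (simp add: det_parent_matrix_rooted)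
    next
      case False
      then show ?thesis by (simp add: det_parent_matrix_not_rooted[OF False assms(1) closed])
    qed
  qed
  have root: "?D (\<lambda>j. of_bool (j = 0)) = of_nat (card (spanning_trees {..<n} E))"
    unfolding expand rooted using sum_rooted_parent_functions[of "{..<n}" E 0] assms by simp
  have "?D (\<lambda>j. 1) = ?D (\<lambda>j. \<Sum>a<n. of_bool (j = a))"
    by (intro arg_cong[where f = Determinant.det] cong_mat) (auto simp: of_bool_def)
  also have "\<dots> = (\<Sum>a<n. ?D (\<lambda>j. of_bool (j = a)))" by (rule det_sum_first_row[OF assms(1)])
  also have "\<dots> = (\<Sum>a<n. ?D (\<lambda>j. of_bool (j = 0)))"
    using rows by (intro sum.cong refl det_unit_first_row) auto
  finally show ?thesis unfolding root by simp
qed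

section \<open>Neighbourhoods in circulant graphs\<close>


lemma add_mod_cancel_left:
  fixes a b i n :: nat
  assumes "i < n" "a < n" "b < n" "(i + a) mod n = (i + b) mod n"
  shows "a = b"
proof -
  have "(i + a) mod n = (if i + a < n then i + a else i + a - n)" if "a < n" for a
    using assms(1) that by (simp add: mod_if)
  from this[OF assms(2)] this[OF assms(3)] show ?thesis
    using assms by (simp split: if_splits)
qed

text \<open>
  Adjacency within the natural numbers; \<open>n - s\<close> stands for \<open>- s\<close> modulo \<open>n\<close>.
\<close>

definition circulant_adjacent :: "nat \<Rightarrow> nat set \<Rightarrow> nat \<Rightarrow> nat \<Rightarrow> bool" where
  "circulant_adjacent n S i j \<longleftrightarrow> (\<exists>s\<in>S. j = (i + s) mod n \<or> j = (i + (n - s)) mod n)"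

lemma circulant_edges_iff:
  assumes "i < n" "j < n" "\<And>s. s \<in> S \<Longrightarrow> s < n"
  shows "{i, j} \<in> circulant_edges n S \<longleftrightarrow> circulant_adjacent n S i j"
proof -
  have adj: "circulant_adjacent n S i j \<longleftrightarrow>
      (\<exists>s\<in>S. int j = (int i + int s) mod int n \<or> int j = (int i - int s) mod int n)" for i j
  proof -
    have "j = (i + s) mod n \<longleftrightarrow> int j = (int i + int s) mod int n" for s
      unfolding of_nat_add[symmetric] of_nat_mod[symmetric] of_nat_eq_iff ..
    moreover have "j = (i + (n - s)) mod n \<longleftrightarrow> int j = (int i - int s) mod int n" if "s \<in> S" for s
    proof -
      have "(int i - int s) mod int n = (int i - int s + int n) mod int n" by simp
      also have "int i - int s + int n = int (i + (n - s))"
        using assms(3)[OF that] by (simp add: of_nat_diff)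
      finally show ?thesis unfolding of_nat_mod[symmetric] of_nat_eq_iff by simp
    qed
    ultimately show ?thesis unfolding circulant_adjacent_def by blast
  qed
  have sym: "circulant_adjacent n S j i" if "circulant_adjacent n S i j" "i < n" for i j
  proof -
    obtain s where s: "s \<in> S" "j = (i + s) mod n \<or> j = (i + (n - s)) mod n"
      using \<open>circulant_adjacent n S i j\<close> unfolding circulant_adjacent_def by blast
    have "s < n" using assms(3) s(1) by blast
    from s(2) have "i = (j + (n - s)) mod n \<or> i = (j + s) mod n"
    proof
      assume "j = (i + s) mod n"
      then have "(j + (n - s)) mod n = (i + s + (n - s)) mod n" by (simp add: mod_add_left_eq)
      also have "\<dots> = i" using \<open>s < n\<close> that(2) by simp
      finally show ?thesis by simp
    next
      assume "j = (i + (n - s)) mod n"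
      then have "(j + s) mod n = (i + (n - s) + s) mod n" by (simp add: mod_add_left_eq)
      also have "\<dots> = i" using \<open>s < n\<close> that(2) by simp
      finally show ?thesis by simp
    qed
    then show ?thesis using s(1) unfolding circulant_adjacent_def by blast
  qed
  have "{i, j} \<in> circulant_edges n S \<longleftrightarrow> circulant_adjacent n S i j \<or> circulant_adjacent n S j i"
    unfolding circulant_edges_def adj using assms(1,2) by (auto simp: doubleton_eq_iff)
  then show ?thesis using sym assms(1,2) by blast
qed

lemma simple_edges_circulant:
  assumes "\<And>s. s \<in> S \<Longrightarrow> 0 < s \<and> s < n"
  shows "simple_edges {..<n} (circulant_edges n S)"
  unfolding simple_edges_def
proof
  fix e assume e: "e \<in> circulant_edges n S"
  then obtain i j where ij: "i < n" "j < n" "e = {i, j}" unfolding circulant_edges_def by blast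
  then have "circulant_adjacent n S i j"
    using e circulant_edges_iff[OF ij(1,2)] assms by blast
  then obtain s where s: "s \<in> S" "j = (i + s) mod n \<or> j = (i + (n - s)) mod n"
    unfolding circulant_adjacent_def by blast
  have "i \<noteq> j"
  proof
    assume "i = j"
    then have "(i + 0) mod n = (i + s) mod n \<or> (i + 0) mod n = (i + (n - s)) mod n"
      using s(2) ij(1) by simp
    then have "0 = s \<or> 0 = n - s"
      using add_mod_cancel_left[of i n 0 s] add_mod_cancel_left[of i n 0 "n - s"] assms[OF s(1)] ij(1) by linarith
    then show False using assms[OF s(1)] by simp
  qed
  then show "\<exists>u\<in>{..<n}. \<exists>v\<in>{..<n}. u \<noteq> v \<and> e = {u, v}" using ij by blast
qed

text \<open>
  The condition \<open>2 * s < n\<close> makes the \<open>2 * card S\<close> listed neighbours distinct.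
\<close>

lemma sum_circulant_neighbours:
  fixes g :: "nat \<Rightarrow> 'a :: comm_monoid_add"
  assumes "finite S" "\<And>s. s \<in> S \<Longrightarrow> 0 < s \<and> 2 * s < n" "i < n"
  shows "(\<Sum>a | {i, a} \<in> circulant_edges n S. g a) =
    (\<Sum>s\<in>S. g ((i + s) mod n) + g ((i + (n - s)) mod n))"
proof -
  let ?p = "\<lambda>s. (i + s) mod n" and ?m = "\<lambda>s. (i + (n - s)) mod n"
  have S: "0 < s" "s < n" "n - s < n" if "s \<in> S" for s using assms(2)[OF that] by auto
  have "simple_edges {..<n} (circulant_edges n S)" using S by (intro simple_edges_circulant) blast
  from simple_edgesD(2)[OF this] have "a < n" if "{i, a} \<in> circulant_edges n S" for a
    using that by blast
  moreover have "?p s < n" "?m s < n" for s using assms(3) by simp_all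
  ultimately have "{a. {i, a} \<in> circulant_edges n S} = {a. circulant_adjacent n S i a}"
    using circulant_edges_iff[OF assms(3) _ S(2)] unfolding circulant_adjacent_def by blast
  also have "\<dots> = ?p ` S \<union> ?m ` S" unfolding circulant_adjacent_def by blast
  finally have N: "{a. {i, a} \<in> circulant_edges n S} = ?p ` S \<union> ?m ` S" .
  have inj: "inj_on ?p S" "inj_on ?m S"
  proof (rule_tac [!] inj_onI)
    fix s t assume st: "s \<in> S" "t \<in> S"
    show "s = t" if "?p s = ?p t"
      using add_mod_cancel_left[OF assms(3) _ _ that] S st by blast
    show "s = t" if "?m s = ?m t"
    proof -
      have "n - s = n - t" using add_mod_cancel_left[OF assms(3) _ _ that] S st by blast
      then show ?thesis using S(2)[OF st(1)] S(2)[OF st(2)] by linarith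
    qed
  qed
  have disj: "?p ` S \<inter> ?m ` S = {}"
  proof (rule ccontr)
    assume "?p ` S \<inter> ?m ` S \<noteq> {}"
    then obtain s t where st: "s \<in> S" "t \<in> S" "?p s = ?m t" by blast
    then have "s = n - t" using add_mod_cancel_left[OF assms(3) _ _ st(3)] S by blast
    then show False using assms(2)[OF st(1)] assms(2)[OF st(2)] by linarith
  qed
  show ?thesis
    unfolding N using assms(1) inj disj
    by (subst sum.union_disjoint) (simp_all add: sum.reindex sum.distrib)
qed

section \<open>Diagonalising the Laplacian\<close>

lemma power_mod_eq:
  fixes z :: "'a :: monoid_mult"
  assumes "z ^ n = 1"
  shows "z ^ (m mod n) = z ^ m"
proof -
  have "z ^ m = z ^ (n * (m div n) + m mod n)" by simp
  also have "\<dots> = z ^ (m mod n)" by (simp only: power_add power_mult assms power_one mult_1_left)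
  finally show ?thesis by simp
qed

text \<open>
  The eigenvalue of the Laplacian on the character \<open>j \<mapsto> z ^ j\<close>.
\<close>

definition circulant_symbol :: "nat set \<Rightarrow> complex \<Rightarrow> complex" where
  "circulant_symbol S z = (\<Sum>s\<in>S. 2 - (z ^ s + inverse (z ^ s)))"

lemma circulant_laplacian_eigenvector:
  fixes z :: complex
  assumes "finite S" "\<And>s. s \<in> S \<Longrightarrow> 0 < s \<and> 2 * s < n" "i < n" "z ^ n = 1"
  shows "(\<Sum>a | {i, a} \<in> circulant_edges n S. z ^ i - z ^ a) = z ^ i * circulant_symbol S z"
proof -
  have "(z ^ i - z ^ ((i + s) mod n)) + (z ^ i - z ^ ((i + (n - s)) mod n)) =
      z ^ i * (2 - (z ^ s + inverse (z ^ s)))" if "s \<in> S" for s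
  proof -
    have "z ^ s * z ^ (n - s) = 1"
      using assms(2)[OF that] assms(4) by (simp flip: power_add)
    then have "z ^ (n - s) = inverse (z ^ s)" by (metis inverse_unique)
    then show ?thesis by (simp add: power_mod_eq[OF assms(4)] power_add algebra_simps)
  qed
  then have "(\<Sum>s\<in>S. (z ^ i - z ^ ((i + s) mod n)) + (z ^ i - z ^ ((i + (n - s)) mod n))) =
      z ^ i * circulant_symbol S z"
    unfolding circulant_symbol_def sum_distrib_left by (intro sum.cong refl)
  moreover have "(\<Sum>a | {i, a} \<in> circulant_edges n S. z ^ i - z ^ a) =
      (\<Sum>s\<in>S. (z ^ i - z ^ ((i + s) mod n)) + (z ^ i - z ^ ((i + (n - s)) mod n)))"
    by (rule sum_circulant_neighbours[OF assms(1-3)])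
  ultimately show ?thesis by (rule trans[rotated])
qed

lemma mat_times_mat:
  fixes f g :: "nat \<times> nat \<Rightarrow> 'a :: comm_semiring_0"
  shows "Matrix.mat n n f * Matrix.mat n n g = Matrix.mat n n (\<lambda>(i, j). \<Sum>k<n. f (i, k) * g (k, j))"
  by (rule eq_matI) (simp_all add: scalar_prod_def atLeast0LessThan)

lemma sum_of_bool_mult:
  fixes f :: "'b \<Rightarrow> 'a :: semiring_1"
  assumes "finite A" "a \<in> A"
  shows "(\<Sum>k\<in>A. of_bool (k = a) * f k) = f a" "(\<Sum>k\<in>A. of_bool (a = k) * f k) = f a"
proof -
  have "(\<Sum>k\<in>A. of_bool (k = a) * f k) = (\<Sum>k\<in>{a}. of_bool (k = a) * f k)"
    using assms by (intro sum.mono_neutral_right) auto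
  then show "(\<Sum>k\<in>A. of_bool (k = a) * f k) = f a" by simp
  then show "(\<Sum>k\<in>A. of_bool (a = k) * f k) = f a" by (simp only: eq_commute[of a])
qed

lemma det_diagonal:
  fixes d :: "nat \<Rightarrow> 'a :: comm_ring_1"
  shows "Determinant.det (Matrix.mat n n (\<lambda>(i, j). if i = j then d i else 0)) = (\<Prod>i<n. d i)"
  by (subst det_lower_triangular[of n]) (simp_all add: prod_list_diag_prod atLeast0LessThan)

context
  fixes n :: nat and w :: complex
  assumes n: "n > 0" and w_pow: "w ^ n = 1" and w_prim: "\<And>k. 0 < k \<Longrightarrow> k < n \<Longrightarrow> w ^ k \<noteq> 1"
begin

lemma primitive_root_nonzero: "w \<noteq> 0"
  using n w_pow by (metis power_0_left zero_neq_one less_numeral_extra(3))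

lemma root_of_unity_power: "(w ^ c) ^ n = 1"
proof -
  have "(w ^ c) ^ n = (w ^ n) ^ c" by (simp only: power_mult[symmetric] mult.commute)
  then show ?thesis by (simp add: w_pow)
qed

lemma primitive_root_inj:
  assumes "a < n" "b < n" "w ^ a = w ^ b"
  shows "a = b"
proof (rule ccontr)
  assume ab: "a \<noteq> b"
  have *: False if "a < b" "b < n" "w ^ a = w ^ b" for a b
  proof -
    have "w ^ b = w ^ a * w ^ (b - a)" using that(1) by (simp flip: power_add)
    then have "w ^ (b - a) = 1" using that(3) primitive_root_nonzero by simp
    then show False using w_prim[of "b - a"] that by simp
  qed
  show False using *[of a b] *[of b a] ab assms by (metis linorder_neqE_nat)
qed

lemma sum_powers_root_of_unity:
  fixes x :: complex
  assumes "x ^ n = 1"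
  shows "(\<Sum>k<n. x ^ k) = (if x = 1 then of_nat n else 0)"
  using assms geometric_sum[of x n] by simp

definition fourier_matrix :: "complex mat" where
  "fourier_matrix = Matrix.mat n n (\<lambda>(j, c). w ^ (j * c))"

lemma det_fourier_matrix: "Determinant.det fourier_matrix \<noteq> 0"
proof -
  define G where "G = Matrix.mat n n (\<lambda>(c, b). inverse (w ^ b) ^ c)"
  have "fourier_matrix * G = Matrix.mat n n (\<lambda>(i, j). if i = j then of_nat n else 0)"
    unfolding fourier_matrix_def G_def mat_times_mat
  proof (rule cong_mat[OF refl refl], simp only: split_conv)
    fix a b assume ab: "a < n" "b < n"
    let ?x = "w ^ a * inverse (w ^ b)"
    have x: "?x ^ n = 1" by (simp add: power_mult_distrib power_inverse root_of_unity_power)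
    have "(\<Sum>c<n. w ^ (a * c) * inverse (w ^ b) ^ c) = (\<Sum>c<n. ?x ^ c)"
      by (simp add: power_mult_distrib power_mult)
    also have "\<dots> = (if ?x = 1 then of_nat n else 0)" by (rule sum_powers_root_of_unity[OF x])
    also have "?x = 1 \<longleftrightarrow> w ^ a = w ^ b" using primitive_root_nonzero by (simp add: field_simps)
    also have "\<dots> \<longleftrightarrow> a = b" using primitive_root_inj[OF ab] by blast
    finally show "(\<Sum>c<n. w ^ (a * c) * inverse (w ^ b) ^ c) = (if a = b then of_nat n else 0)" .
  qed
  then have "Determinant.det (fourier_matrix * G) = of_nat n ^ n"
    by (simp add: det_diagonal)
  also have "Determinant.det (fourier_matrix * G) = Determinant.det fourier_matrix * Determinant.det G"
    by (rule det_mult[of _ n]) (simp_all add: fourier_matrix_def G_def)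
  finally show ?thesis using n by auto
qed

text \<open>
  Let \<open>F\<close> be the Fourier matrix and \<open>D\<close> the diagonal matrix of eigenvalues, with 1 in place of the
  eigenvalue 0. The given matrix \<open>M\<close> is not diagonalised by \<open>F\<close>, but \<open>M * F = X * (U * F) * D\<close>, where \<open>U\<close> puts the
  sum of all rows into the first row and \<open>X\<close> subtracts the first row, divided by \<open>n\<close>, from every other row. Both are
  unitriangular, and \<open>F\<close> is invertible, so the determinant of \<open>M\<close> equals that of \<open>D\<close>.
\<close>

lemma det_ones_row_eigenvectors:
  assumes eigen: "\<And>i c. 0 < i \<Longrightarrow> i < n \<Longrightarrow> c < n \<Longrightarrow> (\<Sum>j<n. m i j * w ^ (j * c)) = w ^ (i * c) * ev c"
    and "ev 0 = 0"
  shows "Determinant.det (Matrix.mat n n (\<lambda>(i, j). if i = 0 then 1 else m i j)) = (\<Prod>c\<in>{1..<n}. ev c)"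
proof -
  let ?M = "Matrix.mat n n (\<lambda>(i, j). if i = 0 then 1 else m i j)"
  define U :: "complex mat" where "U = Matrix.mat n n (\<lambda>(i, j). if i = 0 then 1 else of_bool (i = j))"
  define X :: "complex mat"
    where "X = Matrix.mat n n (\<lambda>(i, j). if i = 0 then of_bool (j = 0) else of_bool (i = j) - of_bool (j = 0) / of_nat n)"
  define D where "D = Matrix.mat n n (\<lambda>(i, j). if i = j then (if i = 0 then 1 else ev i) else 0)"
  define G where "G = Matrix.mat n n (\<lambda>(i, c). if i = 0 then of_nat n * of_bool (c = 0) else w ^ (i * c))"
  define H where "H = Matrix.mat n n (\<lambda>(i, c). if i = 0 then of_nat n * of_bool (c = 0) else w ^ (i * c) - of_bool (c = 0))"
  have delta: "(\<Sum>k<n. of_bool (i = k) * f k) = f i" "(\<Sum>k<n. of_bool (k = i) * f k) = f i"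
    if "i < n" for i and f :: "nat \<Rightarrow> complex"
    using sum_of_bool_mult[of "{..<n}" i f] that by simp_all
  have ones: "(\<Sum>k<n. w ^ (k * c)) = of_nat n * of_bool (c = 0)" if "c < n" for c
  proof -
    have "(\<Sum>k<n. w ^ (k * c)) = (if w ^ c = 1 then of_nat n else 0)"
      using sum_powers_root_of_unity[OF root_of_unity_power, of c] by (simp add: mult.commute flip: power_mult)
    then show ?thesis using w_prim[of c] that by (cases "c = 0") simp_all
  qed
  have UF: "U * fourier_matrix = G"
    unfolding U_def fourier_matrix_def G_def mat_times_mat
  proof (rule cong_mat[OF refl refl], simp only: split_conv)
    fix i c assume "i < n" "c < n"
    then show "(\<Sum>k<n. (if i = 0 then 1 else of_bool (i = k)) * w ^ (k * c)) =
        (if i = 0 then of_nat n * of_bool (c = 0) else w ^ (i * c))"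
      by (cases "i = 0") (simp_all only: if_True if_False mult_1_left ones delta simp_thms)
  qed
  have XG: "X * G = H"
    unfolding X_def G_def H_def mat_times_mat
  proof (rule cong_mat[OF refl refl], simp only: split_conv)
    fix i c assume ic: "i < n" "c < n"
    let ?g = "\<lambda>k. if k = 0 then of_nat n * of_bool (c = 0) else w ^ (k * c)"
    show "(\<Sum>k<n. (if i = 0 then of_bool (k = 0) else of_bool (i = k) - of_bool (k = 0) / of_nat n) * ?g k) =
        (if i = 0 then of_nat n * of_bool (c = 0) else w ^ (i * c) - of_bool (c = 0))"
    proof (cases "i = 0")
      case True
      then show ?thesis using delta(2)[OF n, of ?g] by (simp only: if_True simp_thms)
    next
      case False
      have "(\<Sum>k<n. (of_bool (i = k) - of_bool (k = 0) / of_nat n) * ?g k) =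
          (\<Sum>k<n. of_bool (i = k) * ?g k) - (\<Sum>k<n. of_bool (k = 0) * ?g k) / of_nat n"
        by (simp only: left_diff_distrib sum_subtractf sum_divide_distrib times_divide_eq_left)
      also have "\<dots> = ?g i - ?g 0 / of_nat n" using delta(1)[OF ic(1), of ?g] delta(2)[OF n, of ?g] by (simp only:)
      finally show ?thesis using False n by simp
    qed
  qed
  have "H * D = ?M * fourier_matrix"
    unfolding H_def D_def fourier_matrix_def mat_times_mat
  proof (rule cong_mat[OF refl refl], simp only: split_conv)
    fix i c assume ic: "i < n" "c < n"
    let ?h = "\<lambda>k. if i = 0 then of_nat n * of_bool (k = 0) else w ^ (i * k) - of_bool (k = 0)"
    let ?d = "\<lambda>k. if k = 0 then 1 else ev k"
    have "(\<Sum>k<n. ?h k * (if k = c then ?d k else 0)) = (\<Sum>k<n. of_bool (k = c) * (?h k * ?d k))"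
      by (intro sum.cong refl) simp
    also have "\<dots> = ?h c * ?d c" by (rule delta(2)[OF ic(2)])
    also have "\<dots> = (\<Sum>k<n. (if i = 0 then 1 else m i k) * w ^ (k * c))"
    proof (cases "i = 0")
      case True
      then show ?thesis using ones[OF ic(2)] by (cases "c = 0") simp_all
    next
      case False
      then show ?thesis using eigen[of i c] ic assms(2) by (cases "c = 0") simp_all
    qed
    finally show "(\<Sum>k<n. ?h k * (if k = c then ?d k else 0)) =
        (\<Sum>k<n. (if i = 0 then 1 else m i k) * w ^ (k * c))" .
  qed
  then have "Determinant.det ?M * Determinant.det fourier_matrix = Determinant.det (X * (U * fourier_matrix) * D)"
    unfolding UF XG by (subst det_mult[of _ n, symmetric]) (simp_all add: fourier_matrix_def)
  also have "\<dots> = Determinant.det X * (Determinant.det U * Determinant.det fourier_matrix) * Determinant.det D"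
  proof -
    have c: "X \<in> carrier_mat n n" "U \<in> carrier_mat n n" "fourier_matrix \<in> carrier_mat n n" "D \<in> carrier_mat n n"
      by (simp_all add: X_def U_def fourier_matrix_def D_def)
    then have UFc: "U * fourier_matrix \<in> carrier_mat n n" by (intro mult_carrier_mat)
    then have "X * (U * fourier_matrix) \<in> carrier_mat n n" using c by (intro mult_carrier_mat)
    then show ?thesis using c UFc by (simp only: det_mult)
  qed
  also have "Determinant.det X = 1"
    by (subst det_lower_triangular[of n]) (auto simp: X_def prod_list_diag_prod intro!: prod.neutral)
  also have "Determinant.det U = 1"
    by (subst det_upper_triangular[of _ n]) (auto simp: U_def prod_list_diag_prod upper_triangular_def intro!: prod.neutral)
  also have "Determinant.det D = (\<Prod>c\<in>{1..<n}. ev c)"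
    unfolding D_def det_diagonal atLeast0LessThan[symmetric]
    using n by (subst prod.atLeast_Suc_lessThan) (auto intro!: prod.cong)
  finally show ?thesis using det_fourier_matrix by simp
qed

text \<open>
  Here \<open>w\<close> is a primitive \<open>n\<close>-th root of unity.
\<close>

theorem circulant_tree_number:
  assumes "finite S" "\<And>s. s \<in> S \<Longrightarrow> 0 < s \<and> 2 * s < n"
  shows "of_nat (n * num_circulant_spanning_trees n S) = (\<Prod>c\<in>{1..<n}. circulant_symbol S (w ^ c))"
proof -
  let ?E = "circulant_edges n S"
  let ?m = "\<lambda>i j. \<Sum>a | {i, a} \<in> ?E. of_bool (j = i) - of_bool (j = a) :: complex"
  have simple: "simple_edges {..<n} ?E" using assms(2) by (intro simple_edges_circulant) fastforce
  have "of_nat (n * num_circulant_spanning_trees n S) =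
      Determinant.det (Matrix.mat n n (\<lambda>(i, j). if i = 0 then 1 else ?m i j))"
    unfolding num_circulant_spanning_trees_def by (rule matrix_tree[OF n simple, symmetric])
  also have "\<dots> = (\<Prod>c\<in>{1..<n}. circulant_symbol S (w ^ c))"
  proof (rule det_ones_row_eigenvectors)
    fix i c assume ic: "0 < i" "i < n" "c < n"
    have delta: "(\<Sum>j<n. of_bool (j = a) * w ^ (j * c)) = (w ^ c) ^ a" if "a < n" for a
      using sum_of_bool_mult(1)[of "{..<n}" a "\<lambda>j. w ^ (j * c)"] that
      by (simp add: mult.commute flip: power_mult)
    have "(\<Sum>j<n. ?m i j * w ^ (j * c)) =
        (\<Sum>a | {i, a} \<in> ?E. \<Sum>j<n. (of_bool (j = i) - of_bool (j = a)) * w ^ (j * c))"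
      unfolding sum_distrib_right by (rule sum.swap)
    also have "\<dots> = (\<Sum>a | {i, a} \<in> ?E. (w ^ c) ^ i - (w ^ c) ^ a)"
    proof (rule sum.cong[OF refl])
      fix a assume "a \<in> {a. {i, a} \<in> ?E}"
      then have "a < n" using simple_edgesD(2)[OF simple] by blast
      then show "(\<Sum>j<n. (of_bool (j = i) - of_bool (j = a)) * w ^ (j * c)) = (w ^ c) ^ i - (w ^ c) ^ a"
        by (simp only: left_diff_distrib sum_subtractf delta ic)
    qed
    also have "\<dots> = (w ^ c) ^ i * circulant_symbol S (w ^ c)"
      by (rule circulant_laplacian_eigenvector[OF assms ic(2) root_of_unity_power])
    finally show "(\<Sum>j<n. ?m i j * w ^ (j * c)) = w ^ (i * c) * circulant_symbol S (w ^ c)"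
      by (simp add: mult.commute flip: power_mult)
  qed (simp add: circulant_symbol_def)
  finally show ?thesis .
qed

end

section \<open>Products over roots of unity\<close>

lemma poly_eq_prod_roots:
  fixes p :: "complex poly"
  shows "poly p z = lead_coeff p * (\<Prod>a\<in>#proots p. z - a)"
proof -
  have "poly (\<Prod>a\<in>#M. [:- a, 1:]) z = (\<Prod>a\<in>#M. z - a)" for M :: "complex multiset"
    by (induction M) (simp_all add: algebra_simps)
  then show ?thesis
    using arg_cong[OF complex_poly_decompose_multiset[of p], of "\<lambda>p. poly p z"] by simp
qed


context
  fixes n :: nat and w :: complex
  assumes n: "n > 0" and w_pow: "w ^ n = 1" and w_prim: "\<And>k. 0 < k \<Longrightarrow> k < n \<Longrightarrow> w ^ k \<noteq> 1"
begin

text \<open>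
  Both sides are monic of degree \<open>n\<close> and vanish at the \<open>n\<close> distinct powers of \<open>w\<close>.
\<close>

lemma primitive_root_linear_factors:
  "(\<Prod>c<n. [:- (w ^ c), 1:]) = Polynomial.monom 1 n - 1"
proof (rule poly_eqI_degree_lead_coeff[where n = n and A = "(\<lambda>c. w ^ c) ` {..<n}"])
  let ?p = "\<Prod>c<n. [:- (w ^ c), 1:]"
  have deg: "degree ?p = n" by (subst degree_prod_sum_eq) simp_all
  then show "degree ?p \<le> n" by simp
  have "lead_coeff ?p = 1" by (subst lead_coeff_prod) simp_all
  then show "Polynomial.coeff ?p n = Polynomial.coeff (Polynomial.monom 1 n - 1) n"
    using deg n by (simp add: coeff_diff)
  show "degree (Polynomial.monom 1 n - 1 :: complex poly) \<le> n"
    by (intro degree_diff_le) (simp_all add: degree_monom_le)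
  have "inj_on (\<lambda>c. w ^ c) {..<n}"
    using primitive_root_inj[OF n w_pow w_prim] by (intro inj_onI) auto
  then show "card ((\<lambda>c. w ^ c) ` {..<n}) \<ge> n" by (simp add: card_image)
  fix z assume "z \<in> (\<lambda>c. w ^ c) ` {..<n}"
  then obtain c where c: "c < n" "z = w ^ c" by blast
  have "poly ?p z = (\<Prod>c<n. z - w ^ c)" by (simp add: poly_prod)
  also have "\<dots> = 0" using c by (intro prod_zero) auto
  also have "\<dots> = poly (Polynomial.monom 1 n - 1) z"
    unfolding c(2) using root_of_unity_power[OF n w_pow w_prim, of c] by (simp add: poly_monom)
  finally show "poly ?p z = poly (Polynomial.monom 1 n - 1) z" .
qed

lemma prod_minus_roots_of_unity: "(\<Prod>c<n. x - w ^ c) = x ^ n - 1"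
proof -
  have "(\<Prod>c<n. x - w ^ c) = poly (\<Prod>c<n. [:- (w ^ c), 1:]) x" by (simp add: poly_prod)
  then show ?thesis unfolding primitive_root_linear_factors by (simp add: poly_monom)
qed

text \<open>
  Cancel the factor \<open>x - 1\<close> in the factorization of \<open>x ^ n - 1\<close> and evaluate the resulting geometric sum at 1.
\<close>

lemma prod_one_minus_roots_of_unity: "(\<Prod>c\<in>{1..<n}. 1 - w ^ c) = of_nat n"
proof -
  let ?X = "[:- 1, 1:] :: complex poly"
  have "?X * (\<Prod>c\<in>{1..<n}. [:- (w ^ c), 1:]) = (\<Prod>c<n. [:- (w ^ c), 1:])"
    using n by (simp add: prod.atLeast_Suc_lessThan flip: atLeast0LessThan)
  also have "\<dots> = ?X * (\<Sum>l<n. Polynomial.monom 1 l)"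
  proof -
    have "?X = Polynomial.monom 1 1 - 1" by (simp add: monom_altdef one_pCons)
    then show ?thesis
      unfolding primitive_root_linear_factors
      using power_diff_1_eq[of "Polynomial.monom (1 :: complex) 1" n] by (simp add: monom_power)
  qed
  finally have eq: "?X * (\<Prod>c\<in>{1..<n}. [:- (w ^ c), 1:]) = ?X * (\<Sum>l<n. Polynomial.monom 1 l)" .
  have "?X \<noteq> 0" by simp
  from mult_left_cancel[OF this] eq
  have "(\<Prod>c\<in>{1..<n}. [:- (w ^ c), 1:]) = (\<Sum>l<n. Polynomial.monom 1 l)" by blast
  from arg_cong[OF this, of "\<lambda>p. poly p 1"] show ?thesis
    by (simp add: poly_prod poly_sum poly_monom)
qed

lemma prod_poly_roots_of_unity:
  "(\<Prod>c<n. norm (poly p (w ^ c))) = norm (lead_coeff p) ^ n * (\<Prod>a\<in>#proots p. norm (a ^ n - 1))"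
proof -
  have "(\<Prod>c<n. \<Prod>a\<in>#M. norm (w ^ c - a)) = (\<Prod>a\<in>#M. norm (a ^ n - 1))" for M
  proof (induction M)
    case (add b M)
    have "(\<Prod>c<n. norm (w ^ c - b)) = norm (\<Prod>c<n. b - w ^ c)"
      unfolding prod_norm[symmetric] by (simp only: norm_minus_commute)
    then have "(\<Prod>c<n. norm (w ^ c - b)) = norm (b ^ n - 1)" unfolding prod_minus_roots_of_unity .
    then show ?case by (simp only: image_mset_add_mset prod_mset.add_mset prod.distrib add)
  qed simp
  moreover have "norm (poly p z) = norm (lead_coeff p) * (\<Prod>a\<in>#proots p. norm (z - a))" for z
  proof -
    have "norm (\<Prod>a\<in>#M. z - a) = (\<Prod>a\<in>#M. norm (z - a))" for M :: "complex multiset"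
      by (induction M) (simp_all add: norm_mult)
    then show ?thesis by (simp only: poly_eq_prod_roots[of p] norm_mult)
  qed
  ultimately show ?thesis by (simp only: prod.distrib prod_constant card_lessThan)
qed

end

lemma power_eq_one_imp_dvd:
  fixes w :: "'a :: monoid_mult"
  assumes "w ^ n = 1" "\<And>k. 0 < k \<Longrightarrow> k < n \<Longrightarrow> w ^ k \<noteq> 1" "w ^ m = 1" "n > 0"
  shows "n dvd m"
proof (rule ccontr)
  assume "\<not> n dvd m"
  then have "0 < m mod n" by (simp add: mod_greater_zero_iff_not_dvd)
  moreover have "w ^ (m mod n) = 1" using power_mod_eq[OF assms(1), of m] assms(3) by simp
  ultimately show False using assms(2)[of "m mod n"] assms(4) by simp
qed

lemma primitive_root_power:
  fixes w :: complex
  assumes "w ^ n = 1" "\<And>k. 0 < k \<Longrightarrow> k < n \<Longrightarrow> w ^ k \<noteq> 1" "n > 0" "coprime n d"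
  shows "(w ^ d) ^ n = 1" "\<And>k. 0 < k \<Longrightarrow> k < n \<Longrightarrow> (w ^ d) ^ k \<noteq> 1"
proof -
  show "(w ^ d) ^ n = 1" by (rule root_of_unity_power[OF assms(3,1,2)])
  fix k assume k: "0 < k" "k < n"
  show "(w ^ d) ^ k \<noteq> 1"
  proof
    assume "(w ^ d) ^ k = 1"
    then have "w ^ (d * k) = 1" by (simp only: power_mult)
    then have "n dvd d * k" using power_eq_one_imp_dvd[OF assms(1,2) _ assms(3)] by blast
    then have "n dvd k" using assms(4) by (simp add: coprime_dvd_mult_right_iff)
    then show False using k by (auto dest: dvd_imp_le)
  qed
qed

lemma primitive_root_exists:
  assumes "n > 0"
  obtains w :: complex where "w ^ n = 1" "\<And>k. 0 < k \<Longrightarrow> k < n \<Longrightarrow> w ^ k \<noteq> 1"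
proof
  let ?w = "exp (2 * of_real pi * \<i> * of_nat 1 / of_nat n)"
  show "?w ^ n = 1" using assms by (intro complex_root_unity) simp
  fix k assume k: "0 < k" "k < n"
  have "?w ^ k = exp (2 * of_real pi * \<i> * of_nat k / of_nat n)"
    by (simp add: exp_of_nat_mult[symmetric] mult_ac)
  moreover have "exp (2 * of_real pi * \<i> * of_nat k / of_nat n) \<noteq> exp (2 * of_real pi * \<i> * of_nat 0 / of_nat n)"
    using complex_root_unity_eq[of n k 0] k by simp
  ultimately show "?w ^ k \<noteq> 1" by simp
qed

text \<open>
  The order of \<open>z\<close> divides every exponent in \<open>A\<close>.
\<close>

lemma power_Gcd_eq_one:
  fixes z :: "'a :: monoid_mult"
  assumes "\<And>a. a \<in> A \<Longrightarrow> z ^ a = 1" "b \<in> A" "b > 0"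
  shows "z ^ Gcd A = 1"
proof -
  define m where "m = (LEAST m. 0 < m \<and> z ^ m = 1)"
  have m: "0 < m" "z ^ m = 1"
    unfolding m_def using LeastI[of "\<lambda>m. 0 < m \<and> z ^ m = 1" b] assms by auto
  have min: "z ^ k \<noteq> 1" if "0 < k" "k < m" for k
    using not_less_Least[of k "\<lambda>m. 0 < m \<and> z ^ m = 1"] that unfolding m_def by blast
  have "m dvd a" if "a \<in> A" for a
    using power_eq_one_imp_dvd[OF m(2) min _ m(1)] assms(1)[OF that] by blast
  then have "m dvd Gcd A" by (rule Gcd_greatest)
  then obtain l where "Gcd A = m * l" by (elim dvdE)
  then show ?thesis by (simp add: power_mult m(2))
qed

section \<open>Jensen's formula for the Mahler measure\<close>


definition unit_exp :: "real \<Rightarrow> complex" where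
  "unit_exp t = exp (2 * of_real pi * \<i> * of_real t)"

lemma norm_unit_exp [simp]: "norm (unit_exp t) = 1"
  unfolding unit_exp_def by (simp add: norm_exp_eq_Re)

lemma unit_exp_nonzero [simp]: "unit_exp t \<noteq> 0"
  unfolding unit_exp_def by simp

lemma finite_unit_exp_fibre: "finite {t \<in> {0..1}. unit_exp t = a}"
proof (cases "\<exists>t. unit_exp t = a")
  case True
  then obtain u where u: "unit_exp u = a" by blast
  \<comment> \<open>The fibre is \<open>u\<close> plus integers, and only those in this range stay in the unit interval.\<close>
  let ?K = "{\<lfloor>0 - u\<rfloor>..\<lceil>1 - u\<rceil>}"
  have "{t \<in> {0..1}. unit_exp t = a} \<subseteq> (\<lambda>k. u + of_int k) ` ?K"
  proof
    fix t assume t: "t \<in> {t \<in> {0..1}. unit_exp t = a}"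
    then have "unit_exp t = unit_exp u" using u by simp
    then obtain k :: int where "2 * of_real pi * \<i> * of_real t =
        2 * of_real pi * \<i> * of_real u + of_real (of_int (2 * k) * pi) * \<i>"
      unfolding unit_exp_def exp_eq by blast
    then have "2 * of_real pi * \<i> * complex_of_real t = 2 * of_real pi * \<i> * complex_of_real (u + of_int k)"
      by (simp add: algebra_simps)
    then have "complex_of_real t = complex_of_real (u + of_int k)" by (subst (asm) mult_left_cancel) simp_all
    then have tk: "t = u + of_int k" by (simp only: of_real_eq_iff)
    have "k \<in> ?K" using t tk by (auto simp: floor_le_iff le_ceiling_iff)
    then show "t \<in> (\<lambda>k. u + of_int k) ` ?K" using tk by blast
  qed
  then show ?thesis by (rule finite_subset) simp
next
  case False
  then have "{t \<in> {0..1}. unit_exp t = a} = {}" by blast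
  then show ?thesis by (simp only: finite.emptyI)
qed

text \<open>
  Cauchy's integral formula at the centre of the unit disc.
\<close>

lemma circle_mean_value:
  assumes "f holomorphic_on cball 0 1"
  shows "((\<lambda>t. f (unit_exp t)) has_integral f 0) {0..1}"
proof -
  define c where "c = 2 * of_real pi * \<i>"
  have c: "c \<noteq> 0" unfolding c_def by simp
  have "((\<lambda>u. f u / (u - 0)) has_contour_integral (2 * of_real pi * \<i> * f 0)) (circlepath 0 1)"
    using assms by (rule Cauchy_integral_circlepath_simple) simp
  then have "((\<lambda>t. f (circlepath 0 1 t) / (circlepath 0 1 t - 0) *
      vector_derivative (circlepath 0 1) (at t within {0..1})) has_integral (2 * of_real pi * \<i> * f 0)) {0..1}"
    unfolding has_contour_integral_def .
  moreover have "circlepath 0 1 t = unit_exp t" for t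
    by (simp add: circlepath unit_exp_def)
  moreover have "vector_derivative (circlepath 0 1) (at t within {0..1}) = c * unit_exp t"
    if "t \<in> {0..1}" for t
    using vector_derivative_circlepath01[of t 0 1] that by (simp add: unit_exp_def c_def)
  ultimately have "((\<lambda>t. c * f (unit_exp t)) has_integral (c * f 0)) {0..1}"
    unfolding c_def[symmetric] by (elim has_integral_eq[rotated]) simp
  from has_integral_mult_right[OF this, of "inverse c"]
  show ?thesis using c by (simp only: mult.assoc[symmetric] left_inverse[OF c] mult_1_left)
qed

text \<open>
  The integrand is the real part of the holomorphic function \<open>z \<mapsto> Ln (1 - b * z)\<close>, which vanishes at 0.
\<close>

lemma has_integral_ln_norm_one_minus:
  assumes "norm b < 1"
  shows "((\<lambda>t. ln (norm (1 - b * unit_exp t))) has_integral 0) {0..1}"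
proof -
  have pos: "Re (1 - b * z) > 0" if "z \<in> cball 0 1" for z
  proof -
    have "norm (b * z) \<le> norm b * 1"
      unfolding norm_mult using that by (intro mult_left_mono) simp_all
    then have "Re (b * z) < 1" using assms complex_Re_le_cmod[of "b * z"] by linarith
    then show ?thesis by simp
  qed
  then have not_cut: "1 - b * z \<notin> \<real>\<^sub>\<le>\<^sub>0" if "z \<in> cball 0 1" for z
    using that by (fastforce simp: complex_nonpos_Reals_iff)
  have "(\<lambda>z. Ln (1 - b * z)) holomorphic_on cball 0 1"
    using not_cut by (intro holomorphic_intros) auto
  from has_integral_Re[OF circle_mean_value[OF this]]
  have "((\<lambda>t. Re (Ln (1 - b * unit_exp t))) has_integral 0) {0..1}" by simp
  moreover have "Re (Ln (1 - b * unit_exp t)) = ln (norm (1 - b * unit_exp t))" for t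
  proof (rule Re_Ln)
    show "1 - b * unit_exp t \<noteq> 0" using not_cut[of "unit_exp t"] by force
  qed
  ultimately show ?thesis by (simp only:)
qed

lemma has_integral_ln_norm_outside:
  assumes "norm a > 1"
  shows "((\<lambda>t. ln (norm (unit_exp t - a))) has_integral ln (norm a)) {0..1}"
proof -
  have a: "a \<noteq> 0" "norm (inverse a) < 1" using assms by (auto simp: norm_inverse inverse_less_1_iff)
  have "ln (norm (unit_exp t - a)) = ln (norm a) + ln (norm (1 - inverse a * unit_exp t))" for t
  proof -
    have "a * (inverse a * unit_exp t) = unit_exp t"
      by (simp only: mult.assoc[symmetric] right_inverse[OF a(1)] mult_1_left)
    moreover have "- a * (1 - inverse a * unit_exp t) = a * (inverse a * unit_exp t) - a"
      by (simp add: right_diff_distrib)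
    ultimately have "norm (unit_exp t - a) = norm (- a * (1 - inverse a * unit_exp t))" by (simp only:)
    also have "\<dots> = norm a * norm (1 - inverse a * unit_exp t)" by (simp only: norm_mult norm_minus_cancel)
    finally have eq: "norm (unit_exp t - a) = norm a * norm (1 - inverse a * unit_exp t)" .
    have "unit_exp t \<noteq> a" using assms norm_unit_exp[of t] by (metis less_irrefl)
    then have "norm (unit_exp t - a) \<noteq> 0" by simp
    then have "norm (1 - inverse a * unit_exp t) > 0" unfolding eq by auto
    then show ?thesis unfolding eq using a(1) by (simp add: ln_mult)
  qed
  moreover have "((\<lambda>t. ln (norm a) + ln (norm (1 - inverse a * unit_exp t))) has_integral ln (norm a) + 0) {0..1}"
    using has_integral_const_real[of "ln (norm a)" 0 1]
    by (intro has_integral_add has_integral_ln_norm_one_minus a(2)) simp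
  ultimately show ?thesis by simp
qed

lemma has_integral_ln_norm_inside:
  assumes "norm a < 1"
  shows "((\<lambda>t. ln (norm (unit_exp t - a))) has_integral 0) {0..1}"
proof -
  have "norm (unit_exp t - a) = norm (1 - cnj a * unit_exp t)" for t
  proof -
    have "1 - cnj a * unit_exp t = unit_exp t * cnj (unit_exp t - a)"
      using complex_norm_square[of "unit_exp t"] by (simp add: algebra_simps)
    then have "norm (1 - cnj a * unit_exp t) = norm (unit_exp t) * norm (unit_exp t - a)"
      by (simp only: norm_mult complex_mod_cnj)
    then show ?thesis by simp
  qed
  then show ?thesis using has_integral_ln_norm_one_minus[of "cnj a"] assms by simp
qed

text \<open>
  Moving a point radially outwards from the unit circle moves it away from every point of the circle.
  This is what makes the monotone convergence theorem applicable in the next lemma.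
\<close>

lemma norm_diff_scaled_mono:
  fixes z a :: complex and r r' :: real
  assumes "norm z = 1" "norm a = 1" "1 \<le> r'" "r' \<le> r"
  shows "norm (z - of_real r' * a) \<le> norm (z - of_real r * a)"
proof -
  define c where "c = Re z * Re a + Im z * Im a"
  have z: "(Re z)\<^sup>2 + (Im z)\<^sup>2 = 1" and a: "(Re a)\<^sup>2 + (Im a)\<^sup>2 = 1"
    using assms(1,2) cmod_power2[of z] cmod_power2[of a] by simp_all
  have sq: "(norm (z - of_real x * a))\<^sup>2 = 1 - 2 * x * c + x\<^sup>2" for x
  proof -
    have "(norm (z - of_real x * a))\<^sup>2 = (Re z - x * Re a)\<^sup>2 + (Im z - x * Im a)\<^sup>2"
      by (simp add: cmod_power2)
    also have "\<dots> = ((Re z)\<^sup>2 + (Im z)\<^sup>2) - 2 * x * c + x\<^sup>2 * ((Re a)\<^sup>2 + (Im a)\<^sup>2)"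
      unfolding c_def by (simp add: power2_eq_square algebra_simps)
    finally show ?thesis unfolding z a by simp
  qed
  have "0 \<le> 2 - 2 * c" using sq[of 1] zero_le_power2[of "norm (z - of_real 1 * a)"] by simp
  then have "0 \<le> (r - r') * (r + r' - 2 * c)" using assms(3,4) by (intro mult_nonneg_nonneg) linarith+
  also have "\<dots> = (norm (z - of_real r * a))\<^sup>2 - (norm (z - of_real r' * a))\<^sup>2"
    unfolding sq by (simp add: power2_eq_square algebra_simps)
  finally show ?thesis by (intro power2_le_imp_le[of "norm (z - of_real r' * a)"]) simp_all
qed

text \<open>
  For a singularity on the circle, approach \<open>a\<close> from outside by \<open>(1 + 1 / (k + 1)) * a\<close>: the integrands
  decrease and their integrals \<open>ln (1 + 1 / (k + 1))\<close> tend to 0.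
\<close>

lemma has_integral_ln_norm_unit:
  assumes "norm a = 1"
  shows "((\<lambda>t. ln (norm (unit_exp t - a))) has_integral 0) {0..1}"
proof -
  define N where "N = {t \<in> {0..1}. unit_exp t = a}"
  define r where "r k = 1 + inverse (real (Suc k))" for k
  define f where "f k t = (if t \<in> N then 0 else ln (norm (unit_exp t - of_real (r k) * a)))" for k t
  have r: "r k > 1" for k unfolding r_def by simp
  have r_lim: "r \<longlonglongrightarrow> 1"
    unfolding r_def using tendsto_add[OF tendsto_const LIMSEQ_inverse_real_of_nat, of 1] by simp
  have int: "(f k has_integral ln (r k)) {0..1}" for k
  proof (rule has_integral_spike_finite)
    show "finite N" unfolding N_def by (rule finite_unit_exp_fibre)
    have "norm (of_real (r k) * a) = r k" using assms r[of k] by (simp add: norm_mult)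
    then show "((\<lambda>t. ln (norm (unit_exp t - of_real (r k) * a))) has_integral ln (r k)) {0..1}"
      using has_integral_ln_norm_outside[of "of_real (r k) * a"] r[of k] by simp
  qed (simp add: f_def)
  have "(\<lambda>t. ln (norm (unit_exp t - a))) integrable_on {0..1} \<and>
    (\<lambda>k. integral {0..1} (f k)) \<longlonglongrightarrow> integral {0..1} (\<lambda>t. ln (norm (unit_exp t - a)))"
  proof (rule monotone_convergence_decreasing)
    show "f k integrable_on {0..1}" for k using int[of k] by (rule has_integral_integrable)
    show "f (Suc k) t \<le> f k t" if "t \<in> {0..1}" for k t
    proof (cases "t \<in> N")
      case False
      have "r (Suc k) \<le> r k" unfolding r_def by (simp add: field_simps)
      then have "norm (unit_exp t - of_real (r (Suc k)) * a) \<le> norm (unit_exp t - of_real (r k) * a)"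
        using r[of "Suc k"] assms by (intro norm_diff_scaled_mono) simp_all
      moreover have "norm (unit_exp t - of_real (r (Suc k)) * a) > 0"
      proof -
        have "norm (of_real (r (Suc k)) * a) \<noteq> norm (unit_exp t)"
          using r[of "Suc k"] assms by (simp add: norm_mult)
        then have "unit_exp t \<noteq> of_real (r (Suc k)) * a" by metis
        then show ?thesis by simp
      qed
      ultimately have "ln (norm (unit_exp t - of_real (r (Suc k)) * a)) \<le> ln (norm (unit_exp t - of_real (r k) * a))"
        by (intro ln_mono) linarith+
      then show ?thesis using False by (simp add: f_def)
    qed (simp add: f_def)
    show "(\<lambda>k. f k t) \<longlonglongrightarrow> ln (norm (unit_exp t - a))" if "t \<in> {0..1}" for t
    proof (cases "t \<in> N")
      case True
      \<comment> \<open>At the singularity \<open>ln 0 = 0\<close> agrees with the value chosen for \<open>f\<close>.\<close>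
      then have "ln (norm (unit_exp t - a)) = 0" unfolding N_def by simp
      then show ?thesis using True by (simp add: f_def)
    next
      case False
      then have "unit_exp t \<noteq> a" using that unfolding N_def by blast
      then have "norm (unit_exp t - of_real 1 * a) \<noteq> 0" by simp
      then have "(\<lambda>k. ln (norm (unit_exp t - of_real (r k) * a))) \<longlonglongrightarrow> ln (norm (unit_exp t - of_real 1 * a))"
        by (intro tendsto_intros r_lim)
      then show ?thesis using False by (simp add: f_def)
    qed
    have "integral {0..1} (f k) \<in> {0..ln 2}" for k
    proof -
      have "r k \<le> 2" unfolding r_def by (simp add: field_simps)
      then have "0 \<le> ln (r k)" "ln (r k) \<le> ln 2" using r[of k] by simp_all
      then show ?thesis using integral_unique[OF int[of k]] by simp
    qed
    then show "bounded (range (\<lambda>k. integral {0..1} (f k)))"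
      by (intro bounded_subset[OF bounded_closed_interval]) blast
  qed
  moreover have "(\<lambda>k. integral {0..1} (f k)) \<longlonglongrightarrow> 0"
  proof -
    have "(\<lambda>k. ln (r k)) \<longlonglongrightarrow> ln 1" by (intro tendsto_ln r_lim) simp
    then show ?thesis using integral_unique[OF int] by simp
  qed
  ultimately show ?thesis by (metis LIMSEQ_unique has_integral_iff)
qed

lemma has_integral_ln_norm_linear:
  "((\<lambda>t. ln (norm (unit_exp t - a))) has_integral ln (max 1 (norm a))) {0..1}"
proof -
  consider "norm a > 1" | "norm a < 1" | "norm a = 1" by linarith
  then show ?thesis
  proof cases
    case 1
    then show ?thesis using has_integral_ln_norm_outside[OF 1] by (simp add: max_def)
  next
    case 2
    then show ?thesis using has_integral_ln_norm_inside[OF 2] by (simp add: max_def)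
  next
    case 3
    then show ?thesis using has_integral_ln_norm_unit[OF 3] by simp
  qed
qed

lemma prod_max_one_pos: "(\<Prod>a\<in>#M. max 1 (norm (a :: complex))) > 0"
  by (induction M) (simp_all add: less_max_iff_disj)

lemma has_integral_ln_norm_prod:
  "((\<lambda>t. ln (norm (\<Prod>a\<in>#M. unit_exp t - a))) has_integral ln (\<Prod>a\<in>#M. max 1 (norm a))) {0..1}"
proof (induction M)
  case empty
  show ?case by simp
next
  case (add b M)
  let ?P = "\<lambda>t. \<Prod>a\<in>#M. unit_exp t - a"
  let ?Z = "\<Union>a\<in>set_mset (add_mset b M). {t \<in> {0..1}. unit_exp t = a}"
  have "max 1 (norm b) > 0" by (simp add: less_max_iff_disj)
  from ln_mult_pos[OF this prod_max_one_pos[of M]]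
  have eq: "ln (max 1 (norm b)) + ln (\<Prod>a\<in>#M. max 1 (norm a)) = ln (\<Prod>a\<in>#add_mset b M. max 1 (norm a))"
    by (simp only: image_mset_add_mset prod_mset.add_mset)
  have int: "((\<lambda>t. ln (norm (unit_exp t - b)) + ln (norm (?P t))) has_integral
      ln (max 1 (norm b)) + ln (\<Prod>a\<in>#M. max 1 (norm a))) {0..1}"
    by (intro has_integral_add has_integral_ln_norm_linear add)
  have fin: "finite ?Z" by (intro finite_UN_I finite_set_mset finite_unit_exp_fibre)
  have split: "ln (norm (\<Prod>a\<in>#add_mset b M. unit_exp t - a)) =
      ln (norm (unit_exp t - b)) + ln (norm (?P t))" if "t \<in> {0..1} - ?Z" for t
  proof -
    have "unit_exp t \<notin># add_mset b M" using that by blast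
    then have "unit_exp t \<noteq> b" "0 \<notin># image_mset (\<lambda>a. unit_exp t - a) M" by auto
    then have "norm (unit_exp t - b) > 0" "norm (?P t) > 0" by (simp_all add: prod_mset_zero_iff)
    then show ?thesis by (simp add: norm_mult ln_mult)
  qed
  show ?case by (rule has_integral_spike_finite[OF fin split int[unfolded eq]])
qed

text \<open>
  Jensen's formula, for any function that agrees with a polynomial in absolute value on the unit circle.
\<close>

theorem mahler_measure_poly:
  fixes p :: "complex poly"
  assumes "p \<noteq> 0" "\<And>z. norm z = 1 \<Longrightarrow> norm (f z) = norm (poly p z)"
  shows "mahler_measure f = norm (lead_coeff p) * (\<Prod>a\<in>#proots p. max 1 (norm a))"
proof -
  let ?P = "\<lambda>t. \<Prod>a\<in>#proots p. unit_exp t - a"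
  let ?Z = "\<Union>a\<in>set_mset (proots p). {t \<in> {0..1}. unit_exp t = a}"
  have lc: "norm (lead_coeff p) > 0" using assms(1) by simp
  have "((\<lambda>t. ln (norm (f (unit_exp t)))) has_integral
      ln (norm (lead_coeff p)) + ln (\<Prod>a\<in>#proots p. max 1 (norm a))) {0..1}"
  proof (rule has_integral_spike_finite)
    show "finite ?Z" by (intro finite_UN_I finite_set_mset finite_unit_exp_fibre)
    have "((\<lambda>t. ln (norm (lead_coeff p))) has_integral ln (norm (lead_coeff p))) {0..1::real}"
      using has_integral_const_real[of "ln (norm (lead_coeff p))" 0 1] by simp
    then show "((\<lambda>t. ln (norm (lead_coeff p)) + ln (norm (?P t))) has_integral
        ln (norm (lead_coeff p)) + ln (\<Prod>a\<in>#proots p. max 1 (norm a))) {0..1}"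
      by (intro has_integral_add has_integral_ln_norm_prod)
    fix t assume "t \<in> {0..1} - ?Z"
    then have "unit_exp t \<notin># proots p" by blast
    then have "0 \<notin># image_mset (\<lambda>a. unit_exp t - a) (proots p)" by auto
    then have "norm (?P t) > 0" by (simp add: prod_mset_zero_iff)
    from ln_mult_pos[OF lc this]
    show "ln (norm (f (unit_exp t))) = ln (norm (lead_coeff p)) + ln (norm (?P t))"
      unfolding assms(2)[OF norm_unit_exp] poly_eq_prod_roots[of p] norm_mult .
  qed
  then have "integral {0..1} (\<lambda>t. ln (norm (f (unit_exp t)))) =
      ln (norm (lead_coeff p)) + ln (\<Prod>a\<in>#proots p. max 1 (norm a))" by (rule integral_unique)
  then show ?thesis
    unfolding mahler_measure_def unit_exp_def[symmetric]
    by (simp only: exp_add exp_ln[OF lc] exp_ln[OF prod_max_one_pos])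
qed

section \<open>Growth of the products over the roots\<close>

lemma tendsto_norm_power_minus_one:
  fixes a :: complex
  assumes "norm a \<noteq> 1"
  shows "(\<lambda>n. norm (a ^ n - 1) / max 1 (norm a) ^ n) \<longlonglongrightarrow> 1"
proof (cases "norm a < 1")
  case True
  have "(\<lambda>n. norm (a ^ n - 1)) \<longlonglongrightarrow> norm (0 - 1 :: complex)"
    by (intro tendsto_intros LIMSEQ_power_zero True)
  then show ?thesis using True by (simp add: max_def)
next
  case False
  then have a: "norm a > 1" "a \<noteq> 0" using assms by auto
  have "norm (inverse a) < 1" using a by (simp add: norm_inverse inverse_less_1_iff)
  then have "(\<lambda>n. norm (1 - inverse a ^ n)) \<longlonglongrightarrow> norm (1 - 0 :: complex)"
    by (intro tendsto_intros LIMSEQ_power_zero)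
  moreover have "norm (1 - inverse a ^ n) = norm (a ^ n - 1) / max 1 (norm a) ^ n" for n
  proof -
    have "1 - inverse a ^ n = (a ^ n - 1) / a ^ n" using a(2) by (simp add: power_inverse field_simps)
    then show ?thesis using a(1) by (simp add: norm_divide norm_power max_def)
  qed
  ultimately show ?thesis by simp
qed

text \<open>
  Away from the unit circle the larger of \<open>a ^ n\<close> and 1 dominates their difference.
\<close>

lemma tendsto_prod_norm_power_minus_one:
  fixes M :: "complex multiset"
  assumes "\<And>a. a \<in># M \<Longrightarrow> norm a \<noteq> 1"
  shows "(\<lambda>n. (\<Prod>a\<in>#M. norm (a ^ n - 1)) / (\<Prod>a\<in>#M. max 1 (norm a)) ^ n) \<longlonglongrightarrow> 1"
  using assms
proof (induction M)
  case (add b M)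
  have "(\<lambda>n. (norm (b ^ n - 1) / max 1 (norm b) ^ n) *
      ((\<Prod>a\<in>#M. norm (a ^ n - 1)) / (\<Prod>a\<in>#M. max 1 (norm a)) ^ n)) \<longlonglongrightarrow> 1 * 1"
    using add by (intro tendsto_mult tendsto_norm_power_minus_one) auto
  then show ?case by (simp add: power_mult_distrib)
qed simp

section \<open>Factoring the Laurent polynomial and counting trees\<close>

locale circulant_steps =
  fixes k d :: nat and s :: "nat \<Rightarrow> nat"
  assumes k_pos: "k \<ge> 1" and first_pos: "s 1 \<ge> 1" and mono: "strict_mono_on {1..k} s"
    and d_def: "d = Gcd (s ` {1..k})"
begin

lemma step_bounds:
  assumes "i \<in> {1..k}"
  shows "0 < s i" "s i \<le> s k" "d dvd s i"
proof -
  have mono': "s i \<le> s j" if "i \<in> {1..k}" "j \<in> {1..k}" "i \<le> j" for i j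
    using strict_mono_on_leD[OF mono] that by blast
  show "0 < s i" using mono'[of 1 i] assms k_pos first_pos by simp
  show "s i \<le> s k" using mono'[of i k] assms k_pos by simp
  show "d dvd s i" unfolding d_def using assms by (intro Gcd_dvd) simp
qed

lemma d_pos: "0 < d"
  using step_bounds[of 1] k_pos by (auto intro!: Nat.gr0I)

text \<open>
  The inner sum over \<open>l\<close> is the polynomial \<open>(z ^ s i - 1) / (z ^ d - 1)\<close>.
\<close>

definition cofactor_poly :: "complex poly" where
  "cofactor_poly = (\<Sum>i=1..k. Polynomial.monom 1 (s k - s i) * (\<Sum>l<s i div d. Polynomial.monom 1 (d * l))\<^sup>2)"

lemma poly_cofactor_poly:
  "poly cofactor_poly z = (\<Sum>i=1..k. z ^ (s k - s i) * (\<Sum>l<s i div d. (z ^ d) ^ l)\<^sup>2)"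
  by (simp add: cofactor_poly_def poly_sum poly_monom power_mult)

text \<open>
  Each summand of the Laurent polynomial satisfies
  \<open>z ^ s k * (2 - z ^ s i - z ^ (- s i)) = - z ^ (s k - s i) * (z ^ s i - 1)\<^sup>2\<close>; the power \<open>z ^ s k\<close> clears all
  denominators because \<open>s k\<close> is the largest step.
\<close>

lemma laurent_factorization:
  assumes "z \<noteq> 0"
  shows "z ^ s k * circulant_laurent k s z = - ((z ^ d - 1)\<^sup>2 * poly cofactor_poly z)"
proof -
  have "z ^ s k * (2 - (z ^ s i + z powi (- int (s i)))) =
      - ((z ^ d - 1)\<^sup>2 * (z ^ (s k - s i) * (\<Sum>l<s i div d. (z ^ d) ^ l)\<^sup>2))" if i: "i \<in> {1..k}" for i
  proof -
    have "(z ^ d - 1) * (\<Sum>l<s i div d. (z ^ d) ^ l) = (z ^ d) ^ (s i div d) - 1"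
      by (rule power_diff_1_eq[symmetric])
    also have "(z ^ d) ^ (s i div d) = z ^ s i"
      using step_bounds(3)[OF i] by (simp flip: power_mult)
    finally have g: "(z ^ d - 1) * (\<Sum>l<s i div d. (z ^ d) ^ l) = z ^ s i - 1" .
    have "z ^ s k = z ^ (s k - s i) * z ^ s i"
      using step_bounds(2)[OF i] by (simp flip: power_add)
    moreover have "z ^ s i * (z powi (- int (s i))) = 1"
      using assms by (simp add: power_int_minus)
    ultimately have "z ^ s k * (2 - (z ^ s i + z powi (- int (s i)))) =
        z ^ (s k - s i) * (2 * z ^ s i - z ^ s i * z ^ s i - 1)"
      by (simp add: algebra_simps)
    also have "\<dots> = - (z ^ (s k - s i) * (z ^ s i - 1)\<^sup>2)" by (simp add: power2_eq_square algebra_simps)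
    also have "\<dots> = - ((z ^ d - 1)\<^sup>2 * (z ^ (s k - s i) * (\<Sum>l<s i div d. (z ^ d) ^ l)\<^sup>2))"
      unfolding g[symmetric] by (simp only: power_mult_distrib mult_ac)
    finally show ?thesis .
  qed
  then have "(\<Sum>i=1..k. z ^ s k * (2 - (z ^ s i + z powi (- int (s i))))) =
      - ((z ^ d - 1)\<^sup>2 * poly cofactor_poly z)"
    unfolding poly_cofactor_poly sum_distrib_left sum_negf[symmetric] by (intro sum.cong refl)
  moreover have "circulant_laurent k s z = (\<Sum>i=1..k. 2 - (z ^ s i + z powi (- int (s i))))"
    unfolding circulant_laurent_def by (simp add: sum_subtractf)
  ultimately show ?thesis by (simp only: sum_distrib_left)
qed

lemma norm_laurent:
  assumes "norm z = 1"
  shows "norm (circulant_laurent k s z) = (norm (z ^ d - 1))\<^sup>2 * norm (poly cofactor_poly z)"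
proof -
  have "z \<noteq> 0" using assms by auto
  from arg_cong[OF laurent_factorization[OF this], of norm] show ?thesis
    using assms by (simp add: norm_mult norm_power)
qed

lemma poly_cofactor_root_of_unity:
  assumes "z ^ d = 1"
  shows "poly cofactor_poly z = of_nat (\<Sum>i=1..k. (s i)\<^sup>2) / of_nat (d\<^sup>2)"
proof -
  have "z ^ (s k - s i) * (\<Sum>l<s i div d. (z ^ d) ^ l)\<^sup>2 = of_nat ((s i)\<^sup>2) / of_nat (d\<^sup>2)" if i: "i \<in> {1..k}" for i
  proof -
    have "d dvd s k - s i" using step_bounds(3)[OF i] step_bounds(3)[of k] k_pos by (intro dvd_diff_nat) auto
    then obtain l where "s k - s i = d * l" by (elim dvdE)
    then have "z ^ (s k - s i) = 1" using assms by (simp add: power_mult)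
    moreover obtain t where t: "s i = d * t" using step_bounds(3)[OF i] by (elim dvdE)
    ultimately show ?thesis using assms d_pos by (simp add: power_mult_distrib)
  qed
  then show ?thesis
    unfolding poly_cofactor_poly of_nat_sum sum_divide_distrib by (intro sum.cong refl)
qed

lemma sum_squares_pos: "0 < (\<Sum>i=1..k. (s i)\<^sup>2)"
  using k_pos step_bounds(1) by (intro sum_pos) auto

text \<open>
  On the unit circle the Laurent polynomial is the sum of the nonnegative numbers \<open>2 - 2 * Re (z ^ s i)\<close>. At a
  zero they all vanish, so every \<open>z ^ s i\<close> is 1 and then so is \<open>z ^ d\<close>; but there the cofactor is
  positive.
\<close>

lemma cofactor_nonzero_on_circle:
  assumes "norm z = 1"
  shows "poly cofactor_poly z \<noteq> 0"
proof
  assume zero: "poly cofactor_poly z = 0"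
  have z0: "z \<noteq> 0" using assms by auto
  have "circulant_laurent k s z = 0"
    using norm_laurent[OF assms] zero by simp
  have inv: "z powi (- int m) = cnj (z ^ m)" for m
  proof -
    have "z ^ m * cnj (z ^ m) = 1" using complex_norm_square[of "z ^ m"] assms by (simp add: norm_power)
    then show ?thesis by (simp add: power_int_minus inverse_unique)
  qed
  have "(\<Sum>i=1..k. 2 - 2 * Re (z ^ s i)) = Re (circulant_laurent k s z)"
    unfolding circulant_laurent_def inv by (simp add: sum_subtractf del: complex_cnj_power)
  also have "\<dots> = 0" using \<open>circulant_laurent k s z = 0\<close> by simp
  finally have sum0: "(\<Sum>i=1..k. 2 - 2 * Re (z ^ s i)) = 0" .
  have norm1: "norm (z ^ m) = 1" for m using assms by (simp add: norm_power)
  have nonneg: "0 \<le> 2 - 2 * Re (z ^ m)" for m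
    using complex_Re_le_cmod[of "z ^ m"] norm1[of m] by linarith
  have one: "z ^ s i = 1" if i: "i \<in> {1..k}" for i
  proof -
    have "2 - 2 * Re (z ^ s i) = 0"
      using sum_nonneg_eq_0_iff[of "{1..k}" "\<lambda>i. 2 - 2 * Re (z ^ s i)"] nonneg sum0 i by blast
    then have "Re (z ^ s i) = 1" by simp
    moreover have "(Re (z ^ s i))\<^sup>2 + (Im (z ^ s i))\<^sup>2 = 1"
      using cmod_power2[of "z ^ s i"] norm1[of "s i"] by simp
    ultimately have "Im (z ^ s i) = 0" by simp
    with \<open>Re (z ^ s i) = 1\<close> show ?thesis by (simp add: complex_eq_iff)
  qed
  have "z ^ d = 1"
    unfolding d_def using one step_bounds(1)[of 1] k_pos by (intro power_Gcd_eq_one[of _ _ "s 1"]) auto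
  then show False
    using zero poly_cofactor_root_of_unity[of z] sum_squares_pos d_pos
    by (simp del: of_nat_sum of_nat_power)
qed

lemma mahler_measure_laurent:
  "mahler_measure (circulant_laurent k s) =
    norm (lead_coeff cofactor_poly) * (\<Prod>a\<in>#proots cofactor_poly. max 1 (norm a))"
proof -
  let ?u = "Polynomial.monom 1 d - 1 :: complex poly"
  let ?p = "?u\<^sup>2 * cofactor_poly"
  have "degree (Polynomial.monom 1 d + (- 1) :: complex poly) = d"
    using d_pos by (subst degree_add_eq_left) (simp_all add: degree_monom_eq)
  then have "degree ?u = d" by simp
  moreover have "Polynomial.coeff ?u d = 1" using d_pos by simp
  ultimately have lc: "lead_coeff ?u = 1" by simp
  then have u: "?u \<noteq> 0" by force
  have c: "cofactor_poly \<noteq> 0" using cofactor_nonzero_on_circle[of 1] by force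
  have roots: "norm a = 1" if "a \<in># proots ?u" for a
  proof -
    have "a ^ d = 1" using that u by (simp add: poly_monom)
    then have "norm a ^ d = 1" by (metis norm_one norm_power)
    then show ?thesis using d_pos power_eq_imp_eq_base[of "norm a" d 1] by simp
  qed
  have "mahler_measure (circulant_laurent k s) = norm (lead_coeff ?p) * (\<Prod>a\<in>#proots ?p. max 1 (norm a))"
  proof (rule mahler_measure_poly)
    show "?p \<noteq> 0" using u c by simp
    show "norm (circulant_laurent k s z) = norm (poly ?p z)" if "norm z = 1" for z
      using norm_laurent[OF that] by (simp add: norm_mult norm_power poly_monom)
  qed
  also have "lead_coeff ?p = lead_coeff cofactor_poly"
    by (simp only: lead_coeff_mult lead_coeff_power lc power_one mult_1_left)
  also have "proots ?p = proots ?u + proots ?u + proots cofactor_poly"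
    using u c by (simp add: power2_eq_square proots_mult)
  also have "(\<Prod>a\<in>#proots ?u + proots ?u + proots cofactor_poly. max 1 (norm a)) =
      (\<Prod>a\<in>#proots ?u. max 1 (norm a)) * (\<Prod>a\<in>#proots ?u. max 1 (norm a)) *
      (\<Prod>a\<in>#proots cofactor_poly. max 1 (norm a))"
    by (simp only: image_mset_union prod_mset.union)
  also have "(\<Prod>a\<in>#proots ?u. max 1 (norm a)) = 1"
  proof -
    have "image_mset (\<lambda>a. max 1 (norm a)) (proots ?u) = image_mset (\<lambda>a. 1) (proots ?u)"
      using roots by (intro image_mset_cong) simp
    then show ?thesis by (simp only: prod_mset.neutral_const)
  qed
  finally show ?thesis by simp
qed

lemma circulant_symbol_eq_laurent: "circulant_symbol (s ` {1..k}) z = circulant_laurent k s z"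
proof -
  have "inj_on s {1..k}" using mono by (rule strict_mono_on_imp_inj_on)
  then have "circulant_symbol (s ` {1..k}) z = (\<Sum>i=1..k. 2 - (z ^ s i + inverse (z ^ s i)))"
    unfolding circulant_symbol_def by (subst sum.reindex) simp_all
  then show ?thesis
    unfolding circulant_laurent_def by (simp add: sum_subtractf power_int_minus)
qed

text \<open>
  An exact formula. Coprimality enters through \<open>w ^ d\<close>, which must again be primitive for the
  factor \<open>z ^ d - 1\<close> to contribute \<open>n\<close>.
\<close>

lemma circulant_tree_number_eq:
  assumes "2 * s k < n" "coprime n d"
  shows "real (num_circulant_spanning_trees n (s ` {1..k})) =
    real n * (real d)\<^sup>2 / real (\<Sum>i=1..k. (s i)\<^sup>2) *
      (norm (lead_coeff cofactor_poly) ^ n * (\<Prod>a\<in>#proots cofactor_poly. norm (a ^ n - 1)))"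
proof -
  let ?S = "s ` {1..k}" and ?q = "real (\<Sum>i=1..k. (s i)\<^sup>2)"
  let ?R = "\<lambda>z. norm (poly cofactor_poly z)"
  have n: "n > 0" using assms(1) by simp
  obtain w :: complex where w: "w ^ n = 1" "\<And>k. 0 < k \<Longrightarrow> k < n \<Longrightarrow> w ^ k \<noteq> 1"
    using primitive_root_exists[OF n] by blast
  have norm_w: "norm (w ^ c) = 1" for c
  proof -
    have "norm w ^ n = 1" using w(1) by (metis norm_one norm_power)
    then have "norm w = 1" using n power_eq_imp_eq_base[of "norm w" n 1] by simp
    then show ?thesis by (simp add: norm_power)
  qed
  have "of_nat (n * num_circulant_spanning_trees n ?S) = (\<Prod>c\<in>{1..<n}. circulant_symbol ?S (w ^ c))"
  proof (rule circulant_tree_number[OF n w])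
    fix t assume "t \<in> ?S"
    then obtain i where "i \<in> {1..k}" "t = s i" by blast
    then show "0 < t \<and> 2 * t < n" using step_bounds[of i] assms(1) by simp
  qed simp_all
  from arg_cong[OF this, of norm]
  have "real (n * num_circulant_spanning_trees n ?S) = (\<Prod>c\<in>{1..<n}. norm (circulant_laurent k s (w ^ c)))"
    unfolding norm_of_nat circulant_symbol_eq_laurent prod_norm[symmetric] .
  also have "\<dots> = (\<Prod>c\<in>{1..<n}. norm (1 - (w ^ d) ^ c))\<^sup>2 * (\<Prod>c\<in>{1..<n}. ?R (w ^ c))"
  proof -
    have "(w ^ c) ^ d = (w ^ d) ^ c" for c by (simp only: power_mult[symmetric] mult.commute)
    then show ?thesis
      unfolding norm_laurent[OF norm_w] by (simp only: prod.distrib prod_power_distrib norm_minus_commute)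
  qed
  also have "(\<Prod>c\<in>{1..<n}. norm (1 - (w ^ d) ^ c)) = real n"
  proof -
    have "(\<Prod>c\<in>{1..<n}. 1 - (w ^ d) ^ c) = of_nat n"
      using primitive_root_power[OF w n assms(2)] by (rule prod_one_minus_roots_of_unity[OF n])
    then show ?thesis unfolding prod_norm by simp
  qed
  finally have tau: "real n * real (num_circulant_spanning_trees n ?S) = (real n)\<^sup>2 * (\<Prod>c\<in>{1..<n}. ?R (w ^ c))"
    by simp
  have R1: "?R 1 = ?q / (real d)\<^sup>2"
    using poly_cofactor_root_of_unity[of 1] by (simp add: norm_divide norm_power flip: of_nat_sum of_nat_power)
  have "?R 1 * (\<Prod>c\<in>{1..<n}. ?R (w ^ c)) = (\<Prod>c<n. ?R (w ^ c))"
    using n by (simp add: prod.atLeast_Suc_lessThan flip: atLeast0LessThan)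
  also have "\<dots> = norm (lead_coeff cofactor_poly) ^ n * (\<Prod>a\<in>#proots cofactor_poly. norm (a ^ n - 1))"
    by (rule prod_poly_roots_of_unity[OF n w])
  finally have prod: "?q / (real d)\<^sup>2 * (\<Prod>c\<in>{1..<n}. ?R (w ^ c)) =
      norm (lead_coeff cofactor_poly) ^ n * (\<Prod>a\<in>#proots cofactor_poly. norm (a ^ n - 1))"
    unfolding R1 .
  have q_pos: "?q > 0" using sum_squares_pos by (simp only: of_nat_0_less_iff)
  have dd_pos: "(real d)\<^sup>2 > 0" using d_pos by simp
  have cancel: "m * P = m * D / Q * (Q / D * P)" if "Q > 0" "D > 0" for m P Q D :: real
    using that by simp
  have tau': "real (num_circulant_spanning_trees n ?S) = real n * (\<Prod>c\<in>{1..<n}. ?R (w ^ c))"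
    using tau n by (simp add: power2_eq_square)
  show ?thesis unfolding prod[symmetric] tau' by (rule cancel[OF q_pos dd_pos])
qed

lemma tree_number_ratio_tendsto:
  "((\<lambda>n. real (num_circulant_spanning_trees n (s ` {1..k})) /
      (real n * (real d)\<^sup>2 / real (\<Sum>i=1..k. (s i)\<^sup>2) * mahler_measure (circulant_laurent k s) ^ n)) \<longlongrightarrow> 1)
    (inf sequentially (principal {n. n > 2 * s k \<and> gcd n d = 1}))"
proof -
  let ?M = "proots cofactor_poly" and ?l = "norm (lead_coeff cofactor_poly)"
  let ?F = "inf sequentially (principal {n. n > 2 * s k \<and> gcd n d = 1})"
  have c: "cofactor_poly \<noteq> 0" using cofactor_nonzero_on_circle[of 1] by force
  have "norm a \<noteq> 1" if "a \<in># ?M" for a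
    using that c cofactor_nonzero_on_circle[of a] by auto
  then have "(\<lambda>n. (\<Prod>a\<in>#?M. norm (a ^ n - 1)) / (\<Prod>a\<in>#?M. max 1 (norm a)) ^ n) \<longlonglongrightarrow> 1"
    by (rule tendsto_prod_norm_power_minus_one)
  then have lim: "((\<lambda>n. (\<Prod>a\<in>#?M. norm (a ^ n - 1)) / (\<Prod>a\<in>#?M. max 1 (norm a)) ^ n) \<longlongrightarrow> 1) ?F"
    by (rule tendsto_mono[OF inf_le1])
  have l: "?l > 0" using c by simp
  have "real (num_circulant_spanning_trees n (s ` {1..k})) /
      (real n * (real d)\<^sup>2 / real (\<Sum>i=1..k. (s i)\<^sup>2) * mahler_measure (circulant_laurent k s) ^ n) =
      (\<Prod>a\<in>#?M. norm (a ^ n - 1)) / (\<Prod>a\<in>#?M. max 1 (norm a)) ^ n"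
    if "n > 2 * s k \<and> gcd n d = 1" for n
  proof -
    have n: "2 * s k < n" "coprime n d" using that by (simp_all add: coprime_iff_gcd_eq_1)
    let ?x = "real n * (real d)\<^sup>2 / real (\<Sum>i=1..k. (s i)\<^sup>2)"
    have "?x > 0" using n(1) d_pos sum_squares_pos by (intro divide_pos_pos mult_pos_pos) (simp_all del: of_nat_sum)
    from mult_pos_pos[OF this zero_less_power[OF l]] have "?x * ?l ^ n \<noteq> 0"
      by (rule less_imp_neq[THEN not_sym])
    then show ?thesis
      unfolding circulant_tree_number_eq[OF n] mahler_measure_laurent power_mult_distrib mult.assoc[symmetric]
      by (rule mult_divide_mult_cancel_left)
  qed
  then have "\<forall>\<^sub>F n in ?F. (\<Prod>a\<in>#?M. norm (a ^ n - 1)) / (\<Prod>a\<in>#?M. max 1 (norm a)) ^ n =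
      real (num_circulant_spanning_trees n (s ` {1..k})) /
      (real n * (real d)\<^sup>2 / real (\<Sum>i=1..k. (s i)\<^sup>2) * mahler_measure (circulant_laurent k s) ^ n)"
    unfolding eventually_inf_principal by (intro always_eventually) auto
  from tendsto_cong[OF this] lim show ?thesis by blast
qed

end

theorem theorem5:
  fixes k d q :: nat and s :: "nat \<Rightarrow> nat"
  assumes "k \<ge> 1"
    and "s 1 \<ge> 1"
    and "strict_mono_on {1..k} s"
    and "d = Gcd (s ` {1..k})"
    and "q = (\<Sum>i=1..k. (s i)\<^sup>2)"
  shows "(\<lambda>n. real (num_circulant_spanning_trees n (s ` {1..k})))
           \<sim>[inf sequentially (principal {n. n > 2 * s k \<and> gcd n d = 1})]
         (\<lambda>n. real n * (real d)\<^sup>2 / real q * mahler_measure (circulant_laurent k s) ^ n)"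
proof -
  interpret circulant_steps k d s
    using assms(1-4) by unfold_locales
  show ?thesis
    unfolding assms(5) by (rule asymp_equivI'[OF tree_number_ratio_tendsto])
qed

end
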